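(* Assume the setting described in the context and let $\delta>0$. Let $\rho=d\mathbb P/d\mu$ satisfy $\rho\in P\cap T_\varepsilon$ for all $\varepsilon>0$, and consider corruptions $(\rho_\varepsilon)_{\varepsilon>0}$ and $(\eta_\varepsilon)_{\varepsilon>0}$ such that $\rho_\varepsilon\in P_\varepsilon\cap T_\varepsilon$ and $\eta_\varepsilon\in\mathbf Q_\varepsilon\cap\mathbf T_\varepsilon$ for each $\varepsilon>0$. Assume that $$\lim_{\varepsilon\downarrow0}\theta_\varepsilon=+\infty\qquad\text{and}\qquad\lim_{\varepsilon\downarrow0}\theta_\varepsilon\,\mathcal H(\rho-\rho_\varepsilon,\,I-\eta_\varepsilon)=0.$$ Then $\Phi_\varepsilon^\delta$ weak-strong $\Gamma$-converges to $\Phi^\delta$ as $\varepsilon\downarrow0$, with $X=Z\times\mathbb R$ (weak topology) and $Y=T\times\mathbf T$ (strong topology).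
   Context: Weak-strong $\Gamma$-convergence. For Banach spaces $X,Y$ and functions $\phi_\varepsilon,\phi$ on $X\times Y$ with values in $\overline{\mathbb R}$, $(\phi_\varepsilon)$ weak-strong $\Gamma$-converges to $\phi$ as $\varepsilon\downarrow0$ if (1) for all $(x,y)\in X\times Y$ there is $(x_\varepsilon,y_\varepsilon)_{\varepsilon}$ converging strongly to $(x,y)$ with $\limsup_{\varepsilon\downarrow0}\phi_\varepsilon(x_\varepsilon,y_\varepsilon)\le\phi(x,y)$; and (2) whenever $x_\varepsilon\rightharpoonup x$ weakly in $X$ and $y_\varepsilon\to y$ strongly in $Y$, $\liminf_{\varepsilon\downarrow0}\phi_\varepsilon(x_\varepsilon,y_\varepsilon)\ge\phi(x,y)$. Setting. $Z$ is a reflexive Banach space, $U$ a Banach space, $(\Xi,\mathcal A,\mathbb P)$ a probability space whose sample space $\Xi$ is equipped with a norm $\|\cdot\|_\Xi$. $f_0:Z\to\overline{\mathbb R}$, $g:U\to\overline{\mathbb R}$, $s:\Xi\times Z\to U$ satisfy: $s(\cdot,z)$ is $\mathcal A$-measurable for every $z\in Z$; if $\xi_\varepsilon\to\xi$ in $\Xi$ and $z_\varepsilon\rightharpoonup z$ in $Z$ as $\varepsilon\downarrow0$ then $s(\xi_\varepsilon,z_\varepsilon)\rightharpoonup s(\xi,z)$ in $U$; $f_0$ is proper ($f_0>-\infty$ everywhere, $f_0(z)<+\infty$ for some $z$); $f_0$ and $g$ are sequentially weakly lower semicontinuous (on $Z$ and $U$ respectively). $\kappa$ is the fixed constant weighting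 the expectation in the objective $f_0(z)+\gamma+\kappa\,\mathbb E[(g(s(\cdot,z))-\gamma)_+]$; its value is not specified (the Conditional Value-at-Risk at level $\beta\in(0,1)$ corresponds to $\kappa=(1-\beta)^{-1}$). Measure. $\mu$ is a $\sigma$-finite measure on $(\Xi,\mathcal A)$ with $\mathbb P\ll\mu$; all $L^p$ spaces and a.e. statements refer to $\mu$; $\rho:=d\mathbb P/d\mu$; $I$ is the identity of $\Xi$. $q,q'\in(1,\infty)$ with $1/q+1/q'=1$; $T:=L^q(\Xi)$, $\mathbf T:=L^{q'}(\Xi;\Xi)$. Smoothing. $\zeta:\mathbb R\to\mathbb R$ is continuous, bounded, nonnegative, $\int_{\mathbb R}\zeta=1$, $\int_{\mathbb R}\zeta(x)|x|dx<\infty$, either $\int_{\mathbb R}\zeta(x)x\,dx\le0$ or $\int_{-\infty}^0\zeta(x)|x|dx=0$, and $\{\zeta>0\}$ is connected. $A_\delta(\tau)=\int_{-\infty}^\tau\frac1\delta\zeta(\sigma/\delta)d\sigma$, $(x)_{+,\delta}=\int_{-\infty}^xA_\delta(\tau)d\tau$. Subdomains. $\{\widetilde\Xi_\varepsilon\}_{\varepsilon>0}$ is a family of measurable subspaces of $\Xi$ with $\chi_{\widetilde\Xi_\varepsilon}\to1$ a.e. as $\varepsilon\downarrow0$ ($\chi_S$ is the function equal to $1$ on $S$ and $0$ off $S$); $\{C_n\}_n$ is an increasing countable measurable cover of $\Xi$ with $\mu(C_n)<\infty$; $\Xi_\varepsilon:=\widetilde\Xi_\varepsilon\cap C_{\lceil1/\varepsilon\rceil}$.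 Sets. $P:=\{\varrho:\Xi\to\mathbb R_+\mid\varrho\in L^\infty(\Xi),\int_\Xi\varrho\,d\mu=1\}$; $P_\varepsilon:=\{\varrho:\Xi\to\mathbb R_+\mid\varrho\in L^\infty(\Xi),\ \operatorname{supp}\varrho\subset\Xi_\varepsilon,\ \int_{\Xi_\varepsilon}\varrho\,d\mu=1\}$; $\mathbf Q_\varepsilon:=\{\mathbf t\in L^{q'}(\Xi;\Xi):\operatorname{supp}\mathbf t\subset\Xi_\varepsilon\}$. $W_\varepsilon$, $\mathbf W_\varepsilon$ are reflexive Banach spaces of functions $\Xi_\varepsilon\to\mathbb R$, $\Xi_\varepsilon\to\Xi$, respectively, and, given $\rho_\varepsilon,\eta_\varepsilon$, $T_\varepsilon:=\{t:\Xi\to\mathbb R\mid t|_{\Xi_\varepsilon}\in W_\varepsilon\oplus\operatorname{span}\{\rho_\varepsilon|_{\Xi_\varepsilon}\},\ t|_{\Xi_\varepsilon^c}\in L^q(\Xi_\varepsilon^c)\}$, $\mathbf T_\varepsilon:=\{\mathbf t:\Xi\to\Xi\mid\mathbf t|_{\Xi_\varepsilon}\in\mathbf W_\varepsilon\oplus\operatorname{span}\{I|_{\Xi_\varepsilon},\eta_\varepsilon|_{\Xi_\varepsilon}\},\ \mathbf t|_{\Xi_\varepsilon^c}\in L^{q'}(\Xi_\varepsilon^c;\Xi)\}$ (added elements already contained in $W_\varepsilon$, $\mathbf W_\varepsilon$ are omitted so that the sums are direct). Penalty. $\mathcal H:T\times\mathbf T\to\mathbb R$ is weakly lower semicontinuous,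 coercive, satisfies $\mathcal H(0,0)=0$, and has the property that $\mathcal H(t_k,\mathbf t_k)\to0$ implies $(t_k,\mathbf t_k)\to(0,0)$ strongly; $(\theta_\varepsilon)_{\varepsilon>0}\subset\mathbb R_+$ are penalty parameters. Functionals on $Z\times\mathbb R\times T\times\mathbf T$ (with $\imath_S=0$ on $S$, $+\infty$ off $S$): $$\Phi_\varepsilon^\delta(z,\gamma;t,\mathbf t)=f_0(z)+\gamma+\kappa\int_{\Xi_\varepsilon}\big(g(s(\eta_\varepsilon(\xi)+\mathbf t(\xi),z))-\gamma\big)_{+,\delta}(\rho_\varepsilon(\xi)+t(\xi))\,d\mu(\xi)+\theta_\varepsilon\mathcal H(t,\mathbf t)+\imath_{T_\varepsilon\cap(P-\rho_\varepsilon)}(t)+\imath_{\mathbf T_\varepsilon}(\mathbf t),$$ $$\Phi^\delta(z,\gamma;t,\mathbf t)=\begin{cases}f_0(z)+\gamma+\kappa\int_\Xi\big(g(s(\xi,z))-\gamma\big)_{+,\delta}\,\rho(\xi)\,d\mu(\xi)&\text{if }(t,\mathbf t)=(0,0)\text{ a.e.},\\+\infty&\text{otherwise.}\end{cases}$$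
   Formalization: The penalty H and the weight κ are assumed nonnegative (the claim fails for an H that is negative at one admissible point, and for κ<0 with discontinuous g); I is assumed to lie in L^{q'}(Ξ;Ξ), so that H(ρ−ρ_ε, I−η_ε) is defined. *)

theory Defs
  imports "HOL-Probability.Probability" "HOL-Library.Function_Algebras"
begin

text \<open>Functions carry the pointwise vector space structure, so that function spaces (and the
  dual of a space, and the dual of its dual) are subsets of a type of class
  \<^class>\<open>real_vector\<close>.\<close>

instantiation "fun" :: (type, real_vector) real_vector
begin

definition scaleR_fun :: "real \<Rightarrow> ('a \<Rightarrow> 'b) \<Rightarrow> 'a \<Rightarrow> 'b"
  where "scaleR_fun c f = (\<lambda>x. c *\<^sub>R f x)"

instance
  by standard (simp_all add: scaleR_fun_def fun_eq_iff scaleR_add_right scaleR_add_left)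

end

lemma scaleR_fun_apply [simp]: "(c *\<^sub>R f) x = c *\<^sub>R f x"
  by (simp add: scaleR_fun_def)


section \<open>Normed spaces given by a carrier and a norm\<close>

text \<open>A space is a pair of a carrier \<open>S\<close> and a function \<open>N\<close>. In order to work with
  representatives instead of a.e. classes, \<open>N\<close> is only required to be a seminorm, and the space
  meant is the quotient of \<open>S\<close> by the null space of \<open>N\<close>. A Banach space that is a type is
  the pair of \<^term>\<open>UNIV\<close> and \<^term>\<open>norm\<close>.\<close>

definition seminormed_space :: "'a::real_vector set \<Rightarrow> ('a \<Rightarrow> real) \<Rightarrow> bool" where
  "seminormed_space S N \<longleftrightarrow>
     subspace S \<and> (\<forall>x\<in>S. 0 \<le> N x) \<and> (\<forall>c. \<forall>x\<in>S. N (c *\<^sub>R x) = \<bar>c\<bar> * N x) \<and>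
     (\<forall>x\<in>S. \<forall>y\<in>S. N (x + y) \<le> N x + N y)"

definition norm_complete :: "'a::real_vector set \<Rightarrow> ('a \<Rightarrow> real) \<Rightarrow> bool" where
  "norm_complete S N \<longleftrightarrow>
     (\<forall>x :: nat \<Rightarrow> 'a. (\<forall>n. x n \<in> S) \<and> (\<forall>e>0. \<exists>K. \<forall>m\<ge>K. \<forall>n\<ge>K. N (x m - x n) < e)
        \<longrightarrow> (\<exists>l\<in>S. (\<lambda>n. N (x n - l)) \<longlonglongrightarrow> 0))"

definition dual_space :: "'a::real_vector set \<Rightarrow> ('a \<Rightarrow> real) \<Rightarrow> ('a \<Rightarrow> real) set" where
  "dual_space S N =
     {f. (\<forall>x\<in>S. \<forall>y\<in>S. f (x + y) = f x + f y) \<and> (\<forall>c. \<forall>x\<in>S. f (c *\<^sub>R x) = c * f x) \<and>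
         (\<exists>C. \<forall>x\<in>S. \<bar>f x\<bar> \<le> C * N x)}"

definition dual_norm :: "'a set \<Rightarrow> ('a \<Rightarrow> real) \<Rightarrow> ('a \<Rightarrow> real) \<Rightarrow> real" where
  "dual_norm S N f = Inf {C. 0 \<le> C \<and> (\<forall>x\<in>S. \<bar>f x\<bar> \<le> C * N x)}"

definition reflexive_space :: "'a::real_vector set \<Rightarrow> ('a \<Rightarrow> real) \<Rightarrow> bool" where
  "reflexive_space S N \<longleftrightarrow>
     (\<forall>F \<in> dual_space (dual_space S N) (dual_norm S N). \<exists>x\<in>S. \<forall>f\<in>dual_space S N. F f = f x)"

definition weak_topology :: "'a::real_vector set \<Rightarrow> ('a \<Rightarrow> real) \<Rightarrow> 'a topology" where
  "weak_topology S N = topology_generated_by {S \<inter> f -` B | f B. f \<in> dual_space S N \<and> open B}"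

definition weakly_lsc :: "'a::real_vector set \<Rightarrow> ('a \<Rightarrow> real) \<Rightarrow> ('a \<Rightarrow> real) \<Rightarrow> bool" where
  "weakly_lsc S N h \<longleftrightarrow> (\<forall>c. openin (weak_topology S N) {x\<in>S. c < h x})"

definition seq_weakly_lsc :: "'a::real_vector set \<Rightarrow> ('a \<Rightarrow> real) \<Rightarrow> ('a \<Rightarrow> ereal) \<Rightarrow> bool" where
  "seq_weakly_lsc S N h \<longleftrightarrow>
     (\<forall>x :: nat \<Rightarrow> 'a. \<forall>l. (\<forall>n. x n \<in> S) \<and> limitin (weak_topology S N) x l sequentially
        \<longrightarrow> h l \<le> liminf (\<lambda>n. h (x n)))"

text \<open>The limit \<open>\<epsilon> \<down> 0\<close> is taken along \<^term>\<open>at_right (0::real)\<close>; only the values of a family at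
  \<open>\<epsilon> > 0\<close> matter.\<close>

definition weak_strong_Gamma_converges ::
  "'a::real_vector set \<Rightarrow> ('a \<Rightarrow> real) \<Rightarrow> 'b::real_vector set \<Rightarrow> ('b \<Rightarrow> real) \<Rightarrow>
   (real \<Rightarrow> 'a \<Rightarrow> 'b \<Rightarrow> ereal) \<Rightarrow> ('a \<Rightarrow> 'b \<Rightarrow> ereal) \<Rightarrow> bool" where
  "weak_strong_Gamma_converges X NX Y NY \<phi>\<epsilon> \<phi> \<longleftrightarrow>
     (\<forall>x\<in>X. \<forall>y\<in>Y. \<exists>x\<epsilon> y\<epsilon>.
        (\<forall>\<epsilon>>0. x\<epsilon> \<epsilon> \<in> X \<and> y\<epsilon> \<epsilon> \<in> Y) \<and>
        ((\<lambda>\<epsilon>. NX (x\<epsilon> \<epsilon> - x)) \<longlongrightarrow> 0) (at_right 0) \<and>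
        ((\<lambda>\<epsilon>. NY (y\<epsilon> \<epsilon> - y)) \<longlongrightarrow> 0) (at_right 0) \<and>
        Limsup (at_right 0) (\<lambda>\<epsilon>. \<phi>\<epsilon> \<epsilon> (x\<epsilon> \<epsilon>) (y\<epsilon> \<epsilon>)) \<le> \<phi> x y) \<and>
     (\<forall>x\<in>X. \<forall>y\<in>Y. \<forall>x\<epsilon> y\<epsilon>.
        (\<forall>\<epsilon>>0. x\<epsilon> \<epsilon> \<in> X \<and> y\<epsilon> \<epsilon> \<in> Y) \<longrightarrow>
        limitin (weak_topology X NX) x\<epsilon> x (at_right 0) \<longrightarrow>
        ((\<lambda>\<epsilon>. NY (y\<epsilon> \<epsilon> - y)) \<longlongrightarrow> 0) (at_right 0) \<longrightarrow>
        \<phi> x y \<le> Liminf (at_right 0) (\<lambda>\<epsilon>. \<phi>\<epsilon> \<epsilon> (x\<epsilon> \<epsilon>) (y\<epsilon> \<epsilon>)))"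

lemma limitin_weak_topology:
  "limitin (weak_topology S N) x l F \<longleftrightarrow>
     l \<in> S \<and> eventually (\<lambda>n. x n \<in> S) F \<and> (\<forall>f\<in>dual_space S N. ((\<lambda>n. f (x n)) \<longlongrightarrow> f l) F)"
proof -
  let ?B = "{S \<inter> f -` B | f B. f \<in> dual_space S N \<and> open B}"
  have zero: "(\<lambda>_. 0) \<in> dual_space S N"
    by (auto simp: dual_space_def intro!: exI[of _ 0])
  have top: "\<Union>?B = S"
    using zero by (auto intro!: exI[of _ S] exI[of _ "\<lambda>_. 0"] exI[of _ UNIV])
  have S_open: "openin (weak_topology S N) S"
    using openin_topspace[of "weak_topology S N"] top
    unfolding weak_topology_def by simp
  show ?thesis
  proof
    assume L: "limitin (weak_topology S N) x l F"
    then have lS: "l \<in> S"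
      using top by (simp add: limitin_def weak_topology_def)
    moreover have "eventually (\<lambda>n. x n \<in> S) F"
      using L S_open lS by (auto simp: limitin_def)
    moreover have "((\<lambda>n. f (x n)) \<longlongrightarrow> f l) F" if "f \<in> dual_space S N" for f
    proof (rule topological_tendstoI)
      fix B :: "real set" assume B: "open B" "f l \<in> B"
      have "openin (weak_topology S N) (S \<inter> f -` B)"
        unfolding weak_topology_def
        by (rule topology_generated_by_Basis) (use that B in auto)
      then have "eventually (\<lambda>n. x n \<in> S \<inter> f -` B) F"
        using L lS B by (auto simp: limitin_def)
      then show "eventually (\<lambda>n. f (x n) \<in> B) F"
        by (rule eventually_mono) auto
    qed
    ultimately show "l \<in> S \<and> eventually (\<lambda>n. x n \<in> S) F \<and>
        (\<forall>f\<in>dual_space S N. ((\<lambda>n. f (x n)) \<longlongrightarrow> f l) F)"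
      by blast
  next
    assume R: "l \<in> S \<and> eventually (\<lambda>n. x n \<in> S) F \<and>
        (\<forall>f\<in>dual_space S N. ((\<lambda>n. f (x n)) \<longlongrightarrow> f l) F)"
    have "eventually (\<lambda>n. x n \<in> U) F" if "generate_topology_on ?B U" "l \<in> U" for U
      using that
    proof (induction rule: generate_topology_on.induct)
      case Empty
      then show ?case by simp
    next
      case (Int a b)
      then show ?case by (simp add: eventually_conj)
    next
      case (UN K)
      then obtain k where k: "k \<in> K" "l \<in> k" by auto
      with UN have "eventually (\<lambda>n. x n \<in> k) F" by auto
      then show ?case by (rule eventually_mono) (use k in auto)
    next
      case (Basis s)
      then obtain f B where s: "s = S \<inter> f -` B" "f \<in> dual_space S N" "open B" by blast
      then have "eventually (\<lambda>n. f (x n) \<in> B) F"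
        using R Basis by (intro topological_tendstoD[of _ "f l"]) auto
      with R s show ?case
        by (auto elim: eventually_elim2)
    qed
    then show "limitin (weak_topology S N) x l F"
      using R top by (auto simp: limitin_def weak_topology_def openin_topology_generated_by_iff)
  qed
qed

lemma dual_space_UNIV:
  "dual_space (UNIV :: 'a::real_normed_vector set) norm = Collect bounded_linear"
proof (intro set_eqI iffI)
  fix f assume "f \<in> dual_space (UNIV :: 'a set) norm"
  then obtain C where "\<And>x y. f (x + y) = f x + f y" "\<And>c x. f (c *\<^sub>R x) = c * f x"
      "\<And>x. \<bar>f x\<bar> \<le> C * norm x"
    unfolding dual_space_def by blast
  then have "bounded_linear f"
    by (intro bounded_linear_intro[of f C]) (simp_all add: mult.commute)
  then show "f \<in> Collect bounded_linear" by simp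
next
  fix f :: "'a \<Rightarrow> real" assume "f \<in> Collect bounded_linear"
  then interpret bounded_linear f by simp
  obtain C where "\<And>x. \<bar>f x\<bar> \<le> norm x * C"
    using bounded by auto
  then show "f \<in> dual_space UNIV norm"
    by (auto simp: dual_space_def add scaleR intro!: exI[of _ C] simp: mult.commute)
qed

lemma limitin_weak_topology_UNIV:
  fixes l :: "'a::real_normed_vector"
  shows "limitin (weak_topology UNIV norm) x l F \<longleftrightarrow>
     (\<forall>f. bounded_linear f \<longrightarrow> ((\<lambda>n. f (x n) :: real) \<longlongrightarrow> f l) F)"
  by (simp add: limitin_weak_topology dual_space_UNIV)

lemma reflexive_space_UNIV:
  "reflexive_space (UNIV :: 'a::real_normed_vector set) norm \<longleftrightarrow>
     (\<forall>F :: ('a \<Rightarrow>\<^sub>L real) \<Rightarrow>\<^sub>L real. \<exists>x. \<forall>f. blinfun_apply F f = blinfun_apply f x)"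
proof -
  let ?D = "dual_space (UNIV :: 'a set) norm" and ?n = "dual_norm (UNIV :: 'a set) norm"
  have norm: "?n (blinfun_apply f) = norm f" for f :: "'a \<Rightarrow>\<^sub>L real"
    unfolding dual_norm_def
  proof (rule cInf_eq_minimum)
    show "norm f \<in> {C. 0 \<le> C \<and> (\<forall>x\<in>UNIV. \<bar>blinfun_apply f x\<bar> \<le> C * norm x)}"
      using norm_blinfun[of f] by simp
    fix C assume "C \<in> {C. 0 \<le> C \<and> (\<forall>x\<in>UNIV. \<bar>blinfun_apply f x\<bar> \<le> C * norm x)}"
    then show "norm f \<le> C" by (intro norm_blinfun_bound) auto
  qed
  have D: "f \<in> ?D \<longleftrightarrow> bounded_linear f" for f
    by (simp add: dual_space_UNIV)
  show ?thesis
  proof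
    assume L: "reflexive_space (UNIV :: 'a set) norm"
    show "\<forall>F :: ('a \<Rightarrow>\<^sub>L real) \<Rightarrow>\<^sub>L real. \<exists>x. \<forall>f. blinfun_apply F f = blinfun_apply f x"
    proof
      fix F :: "('a \<Rightarrow>\<^sub>L real) \<Rightarrow>\<^sub>L real"
      let ?F = "\<lambda>f. blinfun_apply F (Blinfun f)"
      have "Blinfun (f + g) = Blinfun f + Blinfun g" if "f \<in> ?D" "g \<in> ?D" for f g
        using that bounded_linear_add[of f g]
        by (intro blinfun_eqI)
          (simp add: D bounded_linear_Blinfun_apply plus_blinfun.rep_eq plus_fun_def)
      moreover have "Blinfun (c *\<^sub>R f) = c *\<^sub>R Blinfun f" if "f \<in> ?D" for f c
        using that bounded_linear_const_scaleR[of f c]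
        by (intro blinfun_eqI)
          (simp add: D bounded_linear_Blinfun_apply scaleR_blinfun.rep_eq scaleR_fun_def)
      moreover have "\<bar>?F f\<bar> \<le> norm F * ?n f" if "f \<in> ?D" for f
        using that norm_blinfun[of F "Blinfun f"] norm[of "Blinfun f"]
        by (simp add: D bounded_linear_Blinfun_apply)
      ultimately have "?F \<in> dual_space ?D ?n"
        unfolding dual_space_def[of ?D]
        by (auto simp: blinfun.add_right blinfun.scaleR_right intro!: exI[of _ "norm F"])
      from bspec[OF L[unfolded reflexive_space_def] this]
      obtain x where x: "\<forall>f\<in>?D. ?F f = f x" ..
      have "blinfun_apply F f = blinfun_apply f x" for f
        using bspec[OF x, of "blinfun_apply f"]
        by (simp add: D blinfun.bounded_linear_right blinfun_apply_inverse)
      then show "\<exists>x. \<forall>f. blinfun_apply F f = blinfun_apply f x" by blast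
    qed
  next
    assume R: "\<forall>F :: ('a \<Rightarrow>\<^sub>L real) \<Rightarrow>\<^sub>L real. \<exists>x. \<forall>f. blinfun_apply F f = blinfun_apply f x"
    show "reflexive_space (UNIV :: 'a set) norm"
      unfolding reflexive_space_def
    proof
      fix F assume F_dual: "F \<in> dual_space ?D ?n"
      then have "\<exists>C. \<forall>f\<in>?D. \<bar>F f\<bar> \<le> C * ?n f"
        by (simp add: dual_space_def[of ?D])
      then obtain C where "\<forall>f\<in>?D. \<bar>F f\<bar> \<le> C * ?n f" ..
      with F_dual have F: "\<And>f g. f \<in> ?D \<Longrightarrow> g \<in> ?D \<Longrightarrow> F (f + g) = F f + F g"
          "\<And>c f. f \<in> ?D \<Longrightarrow> F (c *\<^sub>R f) = c * F f" "\<And>f. f \<in> ?D \<Longrightarrow> \<bar>F f\<bar> \<le> C * ?n f"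
        by (simp_all add: dual_space_def[of ?D])
      let ?F = "\<lambda>f. F (blinfun_apply f)"
      have bl: "blinfun_apply f \<in> ?D" for f
        by (simp add: D blinfun.bounded_linear_right)
      have "blinfun_apply (f + g) = blinfun_apply f + blinfun_apply g" for f g :: "'a \<Rightarrow>\<^sub>L real"
        by (simp add: fun_eq_iff blinfun.add_left)
      moreover have "blinfun_apply (c *\<^sub>R f) = c *\<^sub>R blinfun_apply f" for c and f :: "'a \<Rightarrow>\<^sub>L real"
        by (simp add: fun_eq_iff blinfun.scaleR_left)
      moreover have "\<bar>?F f\<bar> \<le> C * norm f" for f
        using F(3)[OF bl, of f] by (simp only: norm)
      ultimately have "bounded_linear ?F"
        using F(1,2) bl by (intro bounded_linear_intro[of _ C]) (auto simp: mult.commute)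
      then obtain x where x: "\<And>f. ?F f = blinfun_apply f x"
        using R[rule_format, of "Blinfun ?F"] by (auto simp: bounded_linear_Blinfun_apply)
      have "F f = f x" if "f \<in> ?D" for f
        using that x[of "Blinfun f"] by (simp add: D bounded_linear_Blinfun_apply)
      then show "\<exists>x\<in>UNIV. \<forall>f\<in>?D. F f = f x" by blast
    qed
  qed
qed

text \<open>A weakly lower semicontinuous function on representatives is a function on the quotient.\<close>

lemma weakly_lsc_cong:
  assumes "seminormed_space S N" "weakly_lsc S N h" "x \<in> S" "y \<in> S" "N (x - y) = 0"
  shows "h x = h y"
proof -
  have dual: "f x = f y" if f: "f \<in> dual_space S N" for f
  proof -
    from f obtain C where C: "\<forall>x\<in>S. \<bar>f x\<bar> \<le> C * N x" by (auto simp: dual_space_def)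
    have xy: "x - y \<in> S" using assms by (simp add: seminormed_space_def subspace_diff)
    have "f x = f (x - y + y)" by simp
    also have "\<dots> = f (x - y) + f y"
      using f xy assms(4) unfolding dual_space_def by blast
    also have "f (x - y) = 0" using C xy assms(5) by force
    finally show ?thesis by simp
  qed
  have le: "h a \<le> h b" if ab: "a \<in> S" "b \<in> S" "\<And>f. f \<in> dual_space S N \<Longrightarrow> f a = f b" for a b
  proof (rule ccontr)
    assume "\<not> h a \<le> h b"
    then have *: "openin (weak_topology S N) {x\<in>S. h b < h x}" "a \<in> {x\<in>S. h b < h x}"
      using assms(2) ab by (auto simp: weakly_lsc_def)
    have "limitin (weak_topology S N) (\<lambda>_::nat. b) a sequentially"
      unfolding limitin_weak_topology using ab by (metis eventually_True tendsto_const)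
    with * have "eventually (\<lambda>_::nat. b \<in> {x\<in>S. h b < h x}) sequentially"
      unfolding limitin_def by blast
    then show False by simp
  qed
  show ?thesis
  proof (rule antisym)
    show "h x \<le> h y" by (rule le[OF assms(3,4) dual])
    show "h y \<le> h x" by (rule le[OF assms(4,3) dual[symmetric]])
  qed
qed


section \<open>Lebesgue--Bochner spaces\<close>

text \<open>The elements of the spaces below are representatives; all conditions are invariant under
  changes on null sets. Measurability is in the sense of Bochner: the function is an a.e. limit of
  simple functions. For a separable range space this means a.e. equality to a Borel measurable
  function.\<close>

definition bochner_measurable :: "'a measure \<Rightarrow> ('a \<Rightarrow> 'b::real_normed_vector) \<Rightarrow> bool" where
  "bochner_measurable M f \<longleftrightarrow>
     (\<exists>s :: nat \<Rightarrow> 'a \<Rightarrow> 'b. (\<forall>i. simple_function M (s i)) \<and>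
        (AE x in M. (\<lambda>i. s i x) \<longlonglongrightarrow> f x))"

definition Lp_space :: "'a measure \<Rightarrow> real \<Rightarrow> ('a \<Rightarrow> 'b::real_normed_vector) set" where
  "Lp_space M p = {f. bochner_measurable M f \<and> (\<integral>\<^sup>+x. ennreal (norm (f x) powr p) \<partial>M) < \<infinity>}"

definition Lp_norm :: "'a measure \<Rightarrow> real \<Rightarrow> ('a \<Rightarrow> 'b::real_normed_vector) \<Rightarrow> real" where
  "Lp_norm M p f = enn2real (\<integral>\<^sup>+x. ennreal (norm (f x) powr p) \<partial>M) powr (1 / p)"

definition Linf_space :: "'a measure \<Rightarrow> ('a \<Rightarrow> 'b::real_normed_vector) set" where
  "Linf_space M = {f. bochner_measurable M f \<and> (\<exists>C. AE x in M. norm (f x) \<le> C)}"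

definition prod_norm :: "('a \<Rightarrow> real) \<Rightarrow> ('b \<Rightarrow> real) \<Rightarrow> 'a \<times> 'b \<Rightarrow> real" where
  "prod_norm N1 N2 = (\<lambda>(x, y). N1 x + N2 y)"


section \<open>Smoothed positive part\<close>

definition smoothing_kernel :: "(real \<Rightarrow> real) \<Rightarrow> bool" where
  "smoothing_kernel \<zeta> \<longleftrightarrow>
     continuous_on UNIV \<zeta> \<and> bounded (range \<zeta>) \<and> (\<forall>x. 0 \<le> \<zeta> x) \<and>
     integrable lborel \<zeta> \<and> (LBINT x. \<zeta> x) = 1 \<and>
     integrable lborel (\<lambda>x. \<zeta> x * \<bar>x\<bar>) \<and>
     ((LBINT x. \<zeta> x * x) \<le> 0 \<or> (LBINT x:{..0}. \<zeta> x * \<bar>x\<bar>) = 0) \<and>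
     connected {x. 0 < \<zeta> x}"

definition smooth_step :: "(real \<Rightarrow> real) \<Rightarrow> real \<Rightarrow> real \<Rightarrow> real" where
  "smooth_step \<zeta> \<delta> \<tau> = (LBINT \<sigma>:{..\<tau>}. 1 / \<delta> * \<zeta> (\<sigma> / \<delta>))"

text \<open>The smoothed positive part is applied to values of an extended real function, hence the
  extended argument: it is \<open>0\<close> at \<open>-\<infinity>\<close> and the full integral over the line at \<open>\<infinity>\<close>. The
  integrand is nonnegative.\<close>

definition smooth_pos_part :: "(real \<Rightarrow> real) \<Rightarrow> real \<Rightarrow> ereal \<Rightarrow> ennreal" where
  "smooth_pos_part \<zeta> \<delta> x = (\<integral>\<^sup>+\<tau>\<in>{\<tau>. ereal \<tau> \<le> x}. ennreal (smooth_step \<zeta> \<delta> \<tau>) \<partial>lborel)"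


section \<open>Densities, perturbation spaces and functionals\<close>

text \<open>Supports are essential supports: \<open>supp f \<subseteq> D\<close> means that \<open>f\<close> vanishes a.e. outside \<open>D\<close>.\<close>

definition densities :: "'a measure \<Rightarrow> ('a \<Rightarrow> real) set" where
  "densities M =
     {\<rho>. (AE x in M. 0 \<le> \<rho> x) \<and> \<rho> \<in> Linf_space M \<and> (\<integral>\<^sup>+x. ennreal (\<rho> x) \<partial>M) = 1}"

definition densities_on :: "'a measure \<Rightarrow> 'a set \<Rightarrow> ('a \<Rightarrow> real) set" where
  "densities_on M D =
     {\<rho>. (AE x in M. 0 \<le> \<rho> x) \<and> \<rho> \<in> Linf_space M \<and> (AE x in M. x \<notin> D \<longrightarrow> \<rho> x = 0) \<and>
         (\<integral>\<^sup>+x\<in>D. ennreal (\<rho> x) \<partial>M) = 1}"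

definition Lp_supported :: "'a measure \<Rightarrow> real \<Rightarrow> 'a set \<Rightarrow> ('a \<Rightarrow> 'b::real_normed_vector) set" where
  "Lp_supported M p D = {f \<in> Lp_space M p. AE x in M. x \<notin> D \<longrightarrow> f x = 0}"

text \<open>A reflexive Banach space of functions on \<open>D\<close>, given by functions on the whole type that
  vanish outside \<open>D\<close>. Functions of norm \<open>0\<close> vanish a.e.; this admits both spaces of functions and
  spaces of a.e. classes.\<close>

definition reflexive_function_space ::
  "'a measure \<Rightarrow> 'a set \<Rightarrow> ('a \<Rightarrow> 'b::real_vector) set \<Rightarrow> (('a \<Rightarrow> 'b) \<Rightarrow> real) \<Rightarrow> bool" where
  "reflexive_function_space M D W N \<longleftrightarrow>
     seminormed_space W N \<and> norm_complete W N \<and> reflexive_space W N \<and>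
     (\<forall>w\<in>W. \<forall>x. x \<notin> D \<longrightarrow> w x = 0) \<and> (\<forall>w\<in>W. N w = 0 \<longrightarrow> (AE x in M. w x = 0))"

text \<open>The functions whose restriction to \<open>D\<close> lies in \<open>W + span B\<close> (restricted to \<open>D\<close>) and whose
  restriction to the complement of \<open>D\<close> is in \<open>L\<^sup>p\<close>. Leaving out elements of \<open>B\<close> that already lie
  in \<open>W\<close> makes the sum direct but does not change it as a set.\<close>

definition perturbation_space ::
  "'a measure \<Rightarrow> real \<Rightarrow> 'a set \<Rightarrow> ('a \<Rightarrow> 'b::real_normed_vector) set \<Rightarrow> ('a \<Rightarrow> 'b) set \<Rightarrow>
   ('a \<Rightarrow> 'b) set" where
  "perturbation_space M p D W B =
     {f. (\<exists>w\<in>W. \<exists>b\<in>span B. AE x in M. x \<in> D \<longrightarrow> f x = w x + b x) \<and>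
         f \<in> Lp_space (restrict_space M (- D)) p}"

definition indicator_functional :: "'a set \<Rightarrow> 'a \<Rightarrow> ereal" where
  "indicator_functional S x = (if x \<in> S then 0 else \<infinity>)"

text \<open>The integral is a nonnegative Lebesgue integral with values in \<open>[0, \<infinity>]\<close>. This is no
  restriction: where the indicator functional of \<open>t\<close> is finite, the factor
  \<open>\<rho>\<epsilon> + t\<close> is nonnegative a.e., and elsewhere the functional is \<open>\<infinity>\<close>, since \<open>f0\<close> never takes the
  value \<open>-\<infinity>\<close>. The sets \<open>D\<close>, \<open>T\<epsilon>\<close>, \<open>TT\<epsilon>\<close> stand for the subdomain and the two perturbation
  spaces.\<close>

definition Phi_perturbed ::
  "('z \<Rightarrow> ereal) \<Rightarrow> ('u \<Rightarrow> ereal) \<Rightarrow> ('x \<Rightarrow> 'z \<Rightarrow> 'u) \<Rightarrow> real \<Rightarrow> (real \<Rightarrow> real) \<Rightarrow> real \<Rightarrow>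
   'x::real_normed_vector measure \<Rightarrow> (('x \<Rightarrow> real) \<times> ('x \<Rightarrow> 'x) \<Rightarrow> real) \<Rightarrow>
   'x set \<Rightarrow> ('x \<Rightarrow> real) set \<Rightarrow> ('x \<Rightarrow> 'x) set \<Rightarrow> ('x \<Rightarrow> real) \<Rightarrow> ('x \<Rightarrow> 'x) \<Rightarrow> real \<Rightarrow>
   'z \<times> real \<Rightarrow> ('x \<Rightarrow> real) \<times> ('x \<Rightarrow> 'x) \<Rightarrow> ereal" where
  "Phi_perturbed f0 g s \<kappa> \<zeta> \<delta> M H D T\<epsilon> TT\<epsilon> \<rho>\<epsilon> \<eta>\<epsilon> \<theta>\<epsilon> = (\<lambda>(z, \<gamma>) (t, tt).
     f0 z + ereal \<gamma>
     + ereal \<kappa> * enn2ereal (\<integral>\<^sup>+\<xi>\<in>D. smooth_pos_part \<zeta> \<delta> (g (s (\<eta>\<epsilon> \<xi> + tt \<xi>) z) - ereal \<gamma>)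
                              * ennreal (\<rho>\<epsilon> \<xi> + t \<xi>) \<partial>M)
     + ereal (\<theta>\<epsilon> * H (t, tt))
     + indicator_functional (T\<epsilon> \<inter> (\<lambda>\<sigma>. \<sigma> - \<rho>\<epsilon>) ` densities M) t
     + indicator_functional TT\<epsilon> tt)"

definition Phi_limit ::
  "('z \<Rightarrow> ereal) \<Rightarrow> ('u \<Rightarrow> ereal) \<Rightarrow> ('x \<Rightarrow> 'z \<Rightarrow> 'u) \<Rightarrow> real \<Rightarrow> (real \<Rightarrow> real) \<Rightarrow> real \<Rightarrow>
   'x::real_normed_vector measure \<Rightarrow> ('x \<Rightarrow> real) \<Rightarrow>
   'z \<times> real \<Rightarrow> ('x \<Rightarrow> real) \<times> ('x \<Rightarrow> 'x) \<Rightarrow> ereal" where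
  "Phi_limit f0 g s \<kappa> \<zeta> \<delta> M \<rho> = (\<lambda>(z, \<gamma>) (t, tt).
     if AE \<xi> in M. t \<xi> = 0 \<and> tt \<xi> = 0
     then f0 z + ereal \<gamma>
       + ereal \<kappa> * enn2ereal (\<integral>\<^sup>+\<xi>. smooth_pos_part \<zeta> \<delta> (g (s \<xi> z) - ereal \<gamma>)
                                * ennreal (\<rho> \<xi>) \<partial>M)
     else \<infinity>)"

end

theory Submission
  imports Defs
begin

text \<open>Both inequalities rest on the corruption \<open>(\<rho> - \<rho>\<epsilon>, I - \<eta>\<epsilon>)\<close>. Since \<open>\<theta>\<epsilon> \<rightarrow> \<infinity>\<close>, the penalty
  condition forces \<open>H (\<rho> - \<rho>\<epsilon>, I - \<eta>\<epsilon>) \<rightarrow> 0\<close>, so the corruption tends to \<open>0\<close> in norm, and it is a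
  recovery sequence: inserted in the perturbed functional it restores \<open>\<rho>\<close> and \<open>I\<close>.

  For the lower bound let \<open>(z, \<gamma>)\<close> converge weakly and \<open>(t, \<tau>)\<close> strongly. If the limit of
  \<open>(t, \<tau>)\<close> is nonzero, \<open>H\<close> stays away from \<open>0\<close> by lower semicontinuity and the penalty diverges.
  Otherwise \<open>\<rho>\<epsilon> + t \<rightarrow> \<rho>\<close> and \<open>\<eta>\<epsilon> + \<tau> \<rightarrow> I\<close> a.e. along a subsequence, and Fatou's lemma applies;
  the integrands are measurable because \<open>g (s \<xi> z)\<close> is lower semicontinuous in \<open>\<xi>\<close>.\<close>

section \<open>Lebesgue--Bochner spaces\<close>

text \<open>Setting the simple functions and \<open>f\<close> to \<open>0\<close> on a null set that
  contains the points of non-convergence leaves a pointwise limit of Borel functions, which is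
  Borel. Integral estimates go through such a representative, since \<open>f\<close> itself may fail
  to be Borel.\<close>

lemma bochner_measurable_AE_eq_borel:
  fixes f :: "'a \<Rightarrow> 'b::real_normed_vector"
  assumes "bochner_measurable M f"
  obtains f' where "f' \<in> borel_measurable M" "AE x in M. f x = f' x"
proof -
  obtain s :: "nat \<Rightarrow> 'a \<Rightarrow> 'b" where s: "\<And>i. simple_function M (s i)"
    and lim: "AE x in M. (\<lambda>i. s i x) \<longlonglongrightarrow> f x"
    using assms unfolding bochner_measurable_def by blast
  from lim obtain N where N: "N \<in> null_sets M" "{x \<in> space M. \<not> (\<lambda>i. s i x) \<longlonglongrightarrow> f x} \<subseteq> N"
    by (auto simp: eventually_ae_filter)
  define f' where "f' x = (if x \<in> N then 0 else f x)" for x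
  have "(\<lambda>x. if x \<in> N then 0 else s i x) \<in> borel_measurable M" for i
    by (rule measurable_If_set) (use N(1) borel_measurable_simple_function[OF s] in auto)
  moreover have "(\<lambda>i. if x \<in> N then 0 else s i x) \<longlonglongrightarrow> f' x" if "x \<in> space M" for x
    using N(2) that by (auto simp: f'_def)
  ultimately have "f' \<in> borel_measurable M"
    by (rule borel_measurable_LIMSEQ_metric)
  moreover have "AE x in M. f x = f' x"
    using AE_not_in[OF N(1)] by eventually_elim (simp add: f'_def)
  ultimately show thesis by (rule that)
qed

lemma bochner_measurable_diff:
  assumes "bochner_measurable M f" "bochner_measurable M g"
  shows "bochner_measurable M (f - g)"
proof -
  obtain s r where "\<And>i::nat. simple_function M (s i)" "AE x in M. (\<lambda>i. s i x) \<longlonglongrightarrow> f x"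
    "\<And>i::nat. simple_function M (r i)" "AE x in M. (\<lambda>i. r i x) \<longlonglongrightarrow> g x"
    using assms unfolding bochner_measurable_def by blast
  then show ?thesis
    unfolding bochner_measurable_def
    by (intro exI[of _ "\<lambda>i x. s i x - r i x"]) (auto intro: tendsto_diff)
qed

lemma bochner_measurable_uminus:
  assumes "bochner_measurable M f"
  shows "bochner_measurable M (- f)"
proof -
  have "bochner_measurable M (0 :: 'a \<Rightarrow> 'b)"
    unfolding bochner_measurable_def by (auto intro!: exI[of _ "\<lambda>_ _. 0"])
  from bochner_measurable_diff[OF this assms] show ?thesis by simp
qed

lemma bochner_measurable_add:
  assumes "bochner_measurable M f" "bochner_measurable M g"
  shows "bochner_measurable M (f + g)"
  using bochner_measurable_diff[OF assms(1) bochner_measurable_uminus[OF assms(2)]] by simp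

lemma bochner_measurable_restrict_space:
  assumes "bochner_measurable M f" "S \<in> sets M"
  shows "bochner_measurable (restrict_space M S) f"
proof -
  have S: "S \<inter> space M \<in> sets M" "S \<inter> space M = S"
    using assms(2) sets.sets_into_space by auto
  obtain s where s: "\<And>i::nat. simple_function M (s i)" "AE x in M. (\<lambda>i. s i x) \<longlonglongrightarrow> f x"
    using assms(1) unfolding bochner_measurable_def by blast
  \<comment> \<open>Simplicity on the restricted space means that the function cut off by the
    indicator of \<open>S\<close> is simple on \<open>M\<close>.\<close>
  have "simple_function (restrict_space M S) (s i)" for i
    unfolding simple_function_restrict_space[OF S(1)]
    by (intro simple_function_compose2[where h = "(*\<^sub>R)"] simple_function_indicator s assms)
  moreover have "AE x in restrict_space M S. (\<lambda>i. s i x) \<longlonglongrightarrow> f x"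
    using s(2) by (subst AE_restrict_space_iff[OF S(1)]) auto
  ultimately show ?thesis
    unfolding bochner_measurable_def by blast
qed

lemma Lp_space_restrict_space:
  assumes "f \<in> Lp_space M p" "S \<in> sets M"
  shows "f \<in> Lp_space (restrict_space M S) p"
proof -
  have S: "S \<inter> space M \<in> sets M"
    using assms(2) by auto
  have "(\<integral>\<^sup>+x. ennreal (norm (f x) powr p) \<partial>restrict_space M S)
      \<le> (\<integral>\<^sup>+x. ennreal (norm (f x) powr p) \<partial>M)"
    unfolding nn_integral_restrict_space[OF S]
    by (intro nn_integral_mono) (auto simp: indicator_def)
  with assms show ?thesis
    by (auto simp: Lp_space_def intro: bochner_measurable_restrict_space)
qed

text \<open>Bounding both norms by their maximum gives a constant that works for every
  \<open>p > 0\<close>, with no appeal to convexity. Its purpose is the closure of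
  \<open>Lp_space\<close> under differences.\<close>

lemma norm_powr_diff_le:
  fixes a b :: "'b::real_normed_vector"
  assumes "0 < p"
  shows "norm (a - b) powr p \<le> 2 powr p * (norm a powr p + norm b powr p)"
proof -
  have "norm (a - b) \<le> 2 * max (norm a) (norm b)"
    using norm_triangle_ineq4[of a b] by linarith
  then have "norm (a - b) powr p \<le> (2 * max (norm a) (norm b)) powr p"
    using assms by (intro powr_mono2) auto
  also have "\<dots> = 2 powr p * max (norm a) (norm b) powr p"
    by (simp add: powr_mult)
  also have "max (norm a) (norm b) powr p \<le> norm a powr p + norm b powr p"
    by (simp add: max_def)
  finally show ?thesis by simp
qed

lemma Lp_space_diff:
  assumes "f \<in> Lp_space M p" "g \<in> Lp_space M p" "0 < p"
  shows "f - g \<in> Lp_space M p"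
proof -
  obtain f' where f': "f' \<in> borel_measurable M" "AE x in M. f x = f' x"
    using assms(1) bochner_measurable_AE_eq_borel unfolding Lp_space_def by blast
  obtain g' where g': "g' \<in> borel_measurable M" "AE x in M. g x = g' x"
    using assms(2) bochner_measurable_AE_eq_borel unfolding Lp_space_def by blast
  have F: "(\<integral>\<^sup>+x. ennreal (norm (f' x) powr p) \<partial>M) = (\<integral>\<^sup>+x. ennreal (norm (f x) powr p) \<partial>M)"
    by (intro nn_integral_cong_AE) (use f'(2) in auto)
  have G: "(\<integral>\<^sup>+x. ennreal (norm (g' x) powr p) \<partial>M) = (\<integral>\<^sup>+x. ennreal (norm (g x) powr p) \<partial>M)"
    by (intro nn_integral_cong_AE) (use g'(2) in auto)
  have "(\<integral>\<^sup>+x. ennreal (norm ((f - g) x) powr p) \<partial>M)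
      \<le> (\<integral>\<^sup>+x. ennreal (2 powr p) * (ennreal (norm (f' x) powr p) + ennreal (norm (g' x) powr p)) \<partial>M)"
  proof (rule nn_integral_mono_AE, use f'(2) g'(2) in eventually_elim)
    case (elim x)
    then show ?case
      using norm_powr_diff_le[OF assms(3), of "f x" "g x"]
      by (simp flip: ennreal_mult ennreal_plus)
  qed
  also have "\<dots> = ennreal (2 powr p) * ((\<integral>\<^sup>+x. ennreal (norm (f' x) powr p) \<partial>M) + (\<integral>\<^sup>+x. ennreal (norm (g' x) powr p) \<partial>M))"
    using f'(1) g'(1) by (subst nn_integral_cmult) (auto simp: nn_integral_add)
  also have "\<dots> < \<infinity>"
    using assms(1,2) unfolding F G Lp_space_def by (auto simp: ennreal_mult_less_top)
  finally show ?thesis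
    using assms(1,2) by (auto simp: Lp_space_def intro: bochner_measurable_diff)
qed

text \<open>An interpolation: the p-th power of a density is at most its essential bound to the
  power \<open>p - 1\<close> times the density, which has mass one. Boundedness alone would fall
  short on a space of infinite measure.\<close>

lemma densities_subset_Lp_space:
  assumes "1 \<le> p"
  shows "densities M \<subseteq> Lp_space M p"
proof
  fix f assume "f \<in> densities M"
  then obtain B where f: "AE x in M. 0 \<le> f x" "bochner_measurable M f" "AE x in M. norm (f x) \<le> B"
    "(\<integral>\<^sup>+x. ennreal (f x) \<partial>M) = 1"
    by (auto simp: densities_def Linf_space_def)
  obtain f' where f': "f' \<in> borel_measurable M" "AE x in M. f x = f' x"
    using bochner_measurable_AE_eq_borel[OF f(2)] .
  have 1: "(\<integral>\<^sup>+x. ennreal (f' x) \<partial>M) = 1"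
    unfolding f(4)[symmetric] by (intro nn_integral_cong_AE) (use f'(2) in auto)
  have "(\<integral>\<^sup>+x. ennreal (norm (f x) powr p) \<partial>M)
      \<le> (\<integral>\<^sup>+x. ennreal (\<bar>B\<bar> powr (p - 1)) * ennreal (f' x) \<partial>M)"
  proof (rule nn_integral_mono_AE, use f(1,3) f'(2) in eventually_elim)
    case (elim x)
    have "\<bar>f x\<bar> powr p = \<bar>f x\<bar> powr (p - 1) * f x"
      using elim by (cases "f x = 0") (simp_all add: powr_diff)
    also have "\<dots> \<le> \<bar>B\<bar> powr (p - 1) * f x"
      using elim assms by (intro mult_right_mono powr_mono2) auto
    finally show ?case
      using elim by (simp flip: ennreal_mult)
  qed
  also have "\<dots> < \<infinity>"
    using f'(1) by (subst nn_integral_cmult) (auto simp: 1)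
  finally show "f \<in> Lp_space M p"
    using f(2) by (simp add: Lp_space_def)
qed

lemma densities_on_subset_densities:
  "densities_on M D \<subseteq> densities M"
proof
  fix f assume f: "f \<in> densities_on M D"
  then have "(\<integral>\<^sup>+x. ennreal (f x) \<partial>M) = (\<integral>\<^sup>+x\<in>D. ennreal (f x) \<partial>M)"
    by (intro nn_integral_cong_AE) (auto simp: densities_on_def indicator_def)
  with f show "f \<in> densities M"
    by (simp add: densities_on_def densities_def)
qed

lemma Lp_norm_nonneg [simp]: "0 \<le> Lp_norm M p f"
  by (simp add: Lp_norm_def)

lemma Lp_norm_cong_AE:
  assumes "AE x in M. f x = g x"
  shows "Lp_norm M p f = Lp_norm M p g"
  unfolding Lp_norm_def
  by (intro arg_cong[of _ _ "\<lambda>c. enn2real c powr (1 / p)"] nn_integral_cong_AE) (use assms in auto)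

lemma Lp_norm_eq_0_AE:
  assumes "f \<in> Lp_space M p" "Lp_norm M p f = 0"
  shows "AE x in M. f x = 0"
proof -
  obtain f' where f': "f' \<in> borel_measurable M" "AE x in M. f x = f' x"
    using assms(1) bochner_measurable_AE_eq_borel unfolding Lp_space_def by blast
  have "(\<integral>\<^sup>+x. ennreal (norm (f' x) powr p) \<partial>M) = (\<integral>\<^sup>+x. ennreal (norm (f x) powr p) \<partial>M)"
    by (intro nn_integral_cong_AE) (use f'(2) in auto)
  \<comment> \<open>Membership in \<open>Lp_space\<close> rules out an infinite integral, which
    \<open>enn2real\<close> would also send to \<open>0\<close>.\<close>
  also have "\<dots> = 0"
    using assms by (auto simp: Lp_space_def Lp_norm_def enn2real_eq_0_iff)
  finally have "AE x in M. ennreal (norm (f' x) powr p) = 0"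
    using f'(1) by (subst (asm) nn_integral_0_iff_AE) auto
  with f'(2) show ?thesis
    by eventually_elim (auto simp: ennreal_eq_0_iff)
qed

text \<open>The p-th powers of the norms tend to \<open>0\<close> in the mean, so a subsequence of
  them converges a.e.; taking p-th roots returns to the functions.\<close>

lemma Lp_norm_tendsto_0_AE_subseq:
  fixes f :: "nat \<Rightarrow> 'a \<Rightarrow> 'b::real_normed_vector"
  assumes p: "0 < p" and f: "\<And>n. f n \<in> Lp_space M p" and lim: "(\<lambda>n. Lp_norm M p (f n)) \<longlonglongrightarrow> 0"
  obtains r :: "nat \<Rightarrow> nat" where "strict_mono r" "AE x in M. (\<lambda>n. f (r n) x) \<longlonglongrightarrow> 0"
proof -
  have "\<exists>f'. f' \<in> borel_measurable M \<and> (AE x in M. f n x = f' x)" for n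
    using f[of n] bochner_measurable_AE_eq_borel[of M "f n"] unfolding Lp_space_def by blast
  then obtain f' where f': "\<And>n. f' n \<in> borel_measurable M" "\<And>n. AE x in M. f n x = f' n x"
    by metis
  define u where "u n x = norm (f' n x) powr p" for n x
  have u_nonneg [simp]: "0 \<le> u n x" for n x
    by (simp add: u_def)
  have u_meas: "u n \<in> borel_measurable M" for n
    unfolding u_def using f'(1)[of n] by measurable
  have eq: "(\<integral>\<^sup>+x. ennreal (u n x) \<partial>M) = (\<integral>\<^sup>+x. ennreal (norm (f n x) powr p) \<partial>M)" for n
    unfolding u_def by (intro nn_integral_cong_AE) (use f'(2)[of n] in auto)
  have int: "integrable M (u n)" for n
    using f[of n] u_meas[of n] eq[of n]
    by (intro integrableI_nonneg) (auto simp: u_def Lp_space_def)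
  have "(\<integral>x. norm (u n x) \<partial>M) = Lp_norm M p (f n) powr p" for n
  proof -
    have "(\<integral>x. norm (u n x) \<partial>M) = enn2real (\<integral>\<^sup>+x. ennreal (u n x) \<partial>M)"
      using u_meas[of n] by (subst integral_eq_nn_integral) auto
    then show ?thesis
      unfolding eq Lp_norm_def using p by (simp add: powr_powr)
  qed
  moreover have "(\<lambda>n. Lp_norm M p (f n) powr p) \<longlonglongrightarrow> 0"
    using tendsto_powr'[OF lim tendsto_const[of p]] p by (simp add: Lp_norm_def)
  ultimately have "(\<lambda>n. \<integral>x. norm (u n x) \<partial>M) \<longlonglongrightarrow> 0"
    by simp
  from tendsto_L1_AE_subseq[OF int this] obtain r
    where r: "strict_mono r" "AE x in M. (\<lambda>n. u (r n) x) \<longlonglongrightarrow> 0"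
    by blast
  have "AE x in M. \<forall>n. f n x = f' n x"
    using f'(2) by (simp add: AE_all_countable)
  with r(2) have "AE x in M. (\<lambda>n. f (r n) x) \<longlonglongrightarrow> 0"
  proof eventually_elim
    case (elim x)
    have "(\<lambda>n. u (r n) x powr (1 / p)) \<longlonglongrightarrow> 0"
      using tendsto_powr'[OF elim(1) tendsto_const[of "1 / p"]] p by (simp add: u_def)
    then show ?case
      using elim(2) p by (simp add: u_def powr_powr tendsto_norm_zero_iff)
  qed
  with r(1) show thesis by (rule that)
qed

lemma prod_norm_Lp_tendsto_0:
  assumes "((\<lambda>n. prod_norm (Lp_norm M p) (Lp_norm M' p') (f n, g n)) \<longlongrightarrow> 0) F"
  shows "((\<lambda>n. Lp_norm M p (f n)) \<longlongrightarrow> 0) F" "((\<lambda>n. Lp_norm M' p' (g n)) \<longlongrightarrow> 0) F"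
  by (rule tendsto_sandwich[OF _ _ tendsto_const assms]; simp add: prod_norm_def)+

text \<open>The second subsequence is extracted from the first, so the a.e. convergence already
  gained for \<open>f\<close> persists.\<close>

lemma Lp_pair_tendsto_0_AE_subseq:
  fixes f :: "nat \<Rightarrow> 'a \<Rightarrow> 'b::real_normed_vector" and g :: "nat \<Rightarrow> 'a \<Rightarrow> 'c::real_normed_vector"
  assumes p: "0 < p" "0 < p'" and f: "\<And>n. f n \<in> Lp_space M p" and g: "\<And>n. g n \<in> Lp_space M p'"
    and lim: "(\<lambda>n. prod_norm (Lp_norm M p) (Lp_norm M p') (f n, g n)) \<longlonglongrightarrow> 0"
  obtains r :: "nat \<Rightarrow> nat" where "strict_mono r"
    "AE x in M. (\<lambda>n. f (r n) x) \<longlonglongrightarrow> 0" "AE x in M. (\<lambda>n. g (r n) x) \<longlonglongrightarrow> 0"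
proof -
  note lims = prod_norm_Lp_tendsto_0[OF lim]
  obtain r1 :: "nat \<Rightarrow> nat" where r1: "strict_mono r1" "AE x in M. (\<lambda>n. f (r1 n) x) \<longlonglongrightarrow> 0"
    using Lp_norm_tendsto_0_AE_subseq[OF p(1) f lims(1)] .
  obtain r2 :: "nat \<Rightarrow> nat" where r2: "strict_mono r2" "AE x in M. (\<lambda>n. g (r1 (r2 n)) x) \<longlonglongrightarrow> 0"
    using Lp_norm_tendsto_0_AE_subseq[OF p(2), of "\<lambda>n. g (r1 n)" M] g
      LIMSEQ_subseq_LIMSEQ[OF lims(2) r1(1)] by (auto simp: comp_def)
  have "AE x in M. (\<lambda>n. f (r1 (r2 n)) x) \<longlonglongrightarrow> 0"
    using r1(2) by eventually_elim (use LIMSEQ_subseq_LIMSEQ[OF _ r2(1)] in \<open>force simp: comp_def\<close>)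
  with strict_mono_o[OF r1(1) r2(1)] r2(2) show thesis
    by (intro that[of "\<lambda>n. r1 (r2 n)"]) (simp_all add: comp_def)
qed

section \<open>Elements of the perturbation spaces\<close>

lemma perturbation_space_diff:
  assumes "subspace W" "0 < p" "f \<in> perturbation_space M p D W B" "g \<in> perturbation_space M p D W B"
  shows "f - g \<in> perturbation_space M p D W B"
proof -
  from assms(3,4) obtain v b w c where
    "v \<in> W" "b \<in> span B" "AE x in M. x \<in> D \<longrightarrow> f x = v x + b x"
    "w \<in> W" "c \<in> span B" "AE x in M. x \<in> D \<longrightarrow> g x = w x + c x"
    unfolding perturbation_space_def by blast
  then have "v - w \<in> W" "b - c \<in> span B"
    "AE x in M. x \<in> D \<longrightarrow> (f - g) x = (v - w) x + (b - c) x"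
    using assms(1) by (auto simp: subspace_diff span_diff algebra_simps)
  moreover have "f - g \<in> Lp_space (restrict_space M (- D)) p"
    using assms(2-4) by (auto simp: perturbation_space_def intro: Lp_space_diff)
  ultimately show ?thesis
    unfolding perturbation_space_def by blast
qed

text \<open>On \<open>D\<close> the function is its own span part, with \<open>0\<close> as the part
  from \<open>W\<close>; off \<open>D\<close> integrability is inherited by restriction. This is how
  the corruption of the identity gets into its perturbation space.\<close>

lemma span_subset_perturbation_space:
  assumes "subspace W" "- D \<in> sets M" "f \<in> span B" "f \<in> Lp_space M p"
  shows "f \<in> perturbation_space M p D W B"
proof -
  have "0 \<in> W" using assms(1) by (rule subspace_0)
  with assms(3) have "\<exists>w\<in>W. \<exists>b\<in>span B. AE x in M. x \<in> D \<longrightarrow> f x = w x + b x"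
    by (intro bexI[of _ 0] bexI[of _ f]) auto
  then show ?thesis
    using Lp_space_restrict_space[OF assms(4,2)] unfolding perturbation_space_def by blast
qed


section \<open>Limits and lower semicontinuity\<close>

text \<open>Serves two purposes: turning a sequence into a family indexed by \<epsilon>, and letting
  the index of the cover grow as \<epsilon> decreases to zero.\<close>

lemma filterlim_nat_ceiling_inverse_at_right:
  "filterlim (\<lambda>\<epsilon>::real. nat \<lceil>1 / \<epsilon>\<rceil>) at_top (at_right 0)"
proof -
  have "filterlim (\<lambda>\<epsilon>::real. inverse \<epsilon>) at_top (at_right 0)"
    by (rule filterlim_inverse_at_top_right)
  then have "filterlim (\<lambda>\<epsilon>::real. nat \<lceil>inverse \<epsilon>\<rceil>) at_top (at_right 0)"
    unfolding filterlim_at_top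
  proof (intro allI, goal_cases)
    case (1 Z)
    then have "\<forall>\<^sub>F \<epsilon> in at_right 0. real Z \<le> inverse (\<epsilon>::real)" by blast
    then show ?case by eventually_elim linarith
  qed
  then show ?thesis by (simp add: divide_inverse)
qed

lemma filterlim_inverse_of_nat_at_right:
  "filterlim (\<lambda>n::nat. 1 / real n) (at_right 0) sequentially"
proof -
  have "filterlim (\<lambda>n::nat. inverse (real n)) (at_right 0) sequentially"
    by (rule filterlim_compose[OF filterlim_inverse_at_right_top filterlim_real_sequentially])
  then show ?thesis by (simp add: divide_inverse)
qed

lemma filterlim_at_right_sequentiallyI:
  fixes e :: "nat \<Rightarrow> real"
  assumes "\<And>n. a < e n" "e \<longlonglongrightarrow> a"
  shows "filterlim e (at_right a) sequentially"
proof -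
  have "e n \<noteq> a" for n
    using assms(1)[of n] by simp
  with assms show ?thesis
    by (auto simp: filterlim_at)
qed

text \<open>If \<open>F\<close> were at or below some \<open>y < L\<close> arbitrarily close to
  \<open>a\<close>, it would be so along a whole sequence, and the liminf along each further
  subsequence would be at most \<open>y\<close>. The freedom to choose \<open>r\<close> is what lets
  a.e. convergence be extracted from norm convergence.\<close>

lemma Liminf_at_right_geI:
  fixes F :: "real \<Rightarrow> ereal"
  assumes "\<And>e :: nat \<Rightarrow> real. (\<And>k. a < e k) \<Longrightarrow> filterlim e (at_right a) sequentially \<Longrightarrow>
    \<exists>r. strict_mono r \<and> L \<le> liminf (\<lambda>k. F (e (r k)))"
  shows "L \<le> Liminf (at_right a) F"
  unfolding le_Liminf_iff
proof (intro allI impI)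
  fix y assume "y < L"
  show "\<forall>\<^sub>F x in at_right a. y < F x"
  proof (rule sequentially_imp_eventually_at_right[of a "a + 1"])
    fix e :: "nat \<Rightarrow> real" assume e: "\<And>n. a < e n" "e \<longlonglongrightarrow> a"
    show "\<forall>\<^sub>F n in sequentially. y < F (e n)"
    proof (rule ccontr)
      assume "\<not> ?thesis"
      from not_eventually_sequentiallyD[OF this]
      obtain s :: "nat \<Rightarrow> nat" where s: "strict_mono s" "\<And>n. F (e (s n)) \<le> y"
        by (auto simp: not_less)
      have "filterlim (\<lambda>n. e (s n)) (at_right a) sequentially"
        using e(1) LIMSEQ_subseq_LIMSEQ[OF e(2) s(1)]
        by (auto simp: comp_def intro: filterlim_at_right_sequentiallyI)
      with assms[of "\<lambda>n. e (s n)"] e(1) obtain r where "L \<le> liminf (\<lambda>k. F (e (s (r k))))"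
        by blast
      also have "\<dots> \<le> y"
        using s(2) by (intro Liminf_le) auto
      finally show False using \<open>y < L\<close> by simp
    qed
  qed simp
qed

text \<open>Each \<open>y < B\<close> is finite, so \<open>y * c n\<close> tends to
  \<open>y * C\<close> while eventually staying below the product. The supremum over
  \<open>y\<close> gives \<open>B * C\<close>, also when one factor is infinite and the other
  zero.\<close>

lemma ennreal_mult_le_liminf:
  fixes b :: "nat \<Rightarrow> ennreal"
  assumes B: "B \<le> liminf b" and c: "c \<longlonglongrightarrow> C"
  shows "B * C \<le> liminf (\<lambda>n. b n * c n)"
proof -
  have "y * C \<le> liminf (\<lambda>n. b n * c n)" if "y < B" for y
  proof -
    have "(\<lambda>n. y * c n) \<longlonglongrightarrow> y * C"
      using that by (intro ennreal_tendsto_cmult c) (auto simp: less_top[symmetric])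
    then have "y * C = liminf (\<lambda>n. y * c n)"
      by (simp add: lim_imp_Liminf)
    also have "\<forall>\<^sub>F n in sequentially. y < b n"
      using that B by (intro less_LiminfD) auto
    then have "\<forall>\<^sub>F n in sequentially. y * c n \<le> b n * c n"
      by eventually_elim (intro mult_right_mono, auto)
    then have "liminf (\<lambda>n. y * c n) \<le> liminf (\<lambda>n. b n * c n)"
      by (rule Liminf_mono)
    finally show ?thesis .
  qed
  moreover have "B * C = (SUP y\<in>{..<B}. y * C)"
    by (simp flip: SUP_mult_right_ennreal)
  ultimately show ?thesis by (auto intro: SUP_least)
qed

text \<open>Sublevel sets are sequentially closed, hence closed in a metric space.\<close>

lemma borel_measurable_seq_lsc:
  fixes f :: "'a::metric_space \<Rightarrow> 'b::{complete_linorder, linorder_topology, second_countable_topology}"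
  assumes lsc: "\<And>x l. x \<longlonglongrightarrow> l \<Longrightarrow> f l \<le> liminf (\<lambda>n. f (x n))"
  shows "f \<in> borel_measurable borel"
proof (rule borel_measurableI_le)
  fix c
  have "closed {x. f x \<le> c}"
    unfolding closed_sequential_limits
  proof clarsimp
    fix x l assume x: "\<forall>n::nat. f (x n) \<le> c" "x \<longlonglongrightarrow> l"
    have "f l \<le> liminf (\<lambda>n. f (x n))" by (rule lsc) fact
    also have "\<dots> \<le> c" using x(1) by (intro Liminf_le) auto
    finally show "f l \<le> c" .
  qed
  then show "{x \<in> space borel. f x \<le> c} \<in> sets borel" by simp
qed

text \<open>Fatou's lemma for integrands that only have measurable versions: one null set serves all
  the countably many indices, and the integrals do not see the change.\<close>

lemma nn_integral_liminf_AE: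
  assumes "\<And>n::nat. \<exists>f'\<in>borel_measurable M. AE x in M. f n x = f' x"
  shows "(\<integral>\<^sup>+x. liminf (\<lambda>n. f n x) \<partial>M) \<le> liminf (\<lambda>n. \<integral>\<^sup>+x. f n x \<partial>M)"
proof -
  from assms obtain f' where f': "\<And>n. f' n \<in> borel_measurable M" "\<And>n. AE x in M. f n x = f' n x"
    by metis
  have "AE x in M. \<forall>n. f n x = f' n x"
    using f'(2) by (simp add: AE_all_countable)
  then have "(\<integral>\<^sup>+x. liminf (\<lambda>n. f n x) \<partial>M) = (\<integral>\<^sup>+x. liminf (\<lambda>n. f' n x) \<partial>M)"
    by (intro nn_integral_cong_AE) auto
  also have "\<dots> \<le> liminf (\<lambda>n. \<integral>\<^sup>+x. f' n x \<partial>M)"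
    by (rule nn_integral_liminf) (rule f')
  also have "(\<lambda>n. \<integral>\<^sup>+x. f' n x \<partial>M) = (\<lambda>n. \<integral>\<^sup>+x. f n x \<partial>M)"
    using f'(2) by (intro ext nn_integral_cong_AE) (auto simp: eq_commute)
  finally show ?thesis .
qed

lemma liminf_enn2ereal:
  "liminf (\<lambda>n. enn2ereal (f n)) = enn2ereal (liminf f)"
  by (rule Liminf_compose_continuous_mono)
     (auto simp: mono_def continuous_on_enn2ereal less_eq_ennreal.rep_eq)

lemma ereal_minus_le_liminf:
  fixes a :: "nat \<Rightarrow> ereal"
  assumes "A \<le> liminf a" "c \<longlonglongrightarrow> C"
  shows "A - ereal C \<le> liminf (\<lambda>n. a n - ereal (c n))"
proof -
  have "(\<lambda>n. - ereal (c n)) \<longlonglongrightarrow> - ereal C"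
    using assms(2) by (simp add: tendsto_minus)
  from ereal_liminf_lim_add[OF this, of a]
  have "liminf (\<lambda>n. a n - ereal (c n)) = liminf a - ereal C"
    by (simp add: minus_ereal_def add.commute)
  then show ?thesis
    using assms(1) by (simp add: ereal_minus_mono)
qed

text \<open>Elements of the dual are dominated by \<open>N\<close>, so convergence in
  \<open>N\<close> is weak convergence, and the superlevel sets of \<open>h\<close> are weakly open.
  Closure under differences lets the dual bound be applied to \<open>y n - x\<close>.\<close>

lemma weakly_lsc_eventually_gt:
  assumes "weakly_lsc S N h" "x \<in> S" and diff: "\<And>a b. a \<in> S \<Longrightarrow> b \<in> S \<Longrightarrow> a - b \<in> S"
    and y: "\<forall>\<^sub>F n in F. y n \<in> S" "((\<lambda>n. N (y n - x)) \<longlongrightarrow> 0) F" and "c < h x"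
  shows "\<forall>\<^sub>F n in F. c < h (y n)"
proof -
  have "((\<lambda>n. f (y n)) \<longlongrightarrow> f x) F" if f: "f \<in> dual_space S N" for f
  proof -
    obtain C where C: "\<And>a. a \<in> S \<Longrightarrow> \<bar>f a\<bar> \<le> C * N a"
      using f unfolding dual_space_def by blast
    have "((\<lambda>n. C * N (y n - x)) \<longlongrightarrow> 0) F"
      using tendsto_mult_left[OF y(2), of C] by simp
    moreover have "\<forall>\<^sub>F n in F. norm (f (y n) - f x) \<le> C * N (y n - x)"
      using y(1)
    proof eventually_elim
      case (elim n)
      have "f (y n - x + x) = f (y n - x) + f x"
        using f diff[OF elim assms(2)] assms(2) unfolding dual_space_def by blast
      then show ?case
        using C[OF diff[OF elim assms(2)]] by simp
    qed
    ultimately have "((\<lambda>n. f (y n) - f x) \<longlongrightarrow> 0) F"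
      by (rule Lim_null_comparison[rotated])
    then show ?thesis by (simp add: LIM_zero_iff)
  qed
  then have "limitin (weak_topology S N) y x F"
    using assms(2) y(1) by (simp add: limitin_weak_topology)
  moreover have "openin (weak_topology S N) {a \<in> S. c < h a}" "x \<in> {a \<in> S. c < h a}"
    using assms by (auto simp: weakly_lsc_def)
  ultimately have "\<forall>\<^sub>F n in F. y n \<in> {a \<in> S. c < h a}"
    unfolding limitin_def by blast
  then show ?thesis by (rule eventually_mono) simp
qed

lemma limitin_weak_topology_UNIV_compose:
  fixes l :: "'a::real_normed_vector"
  assumes "limitin (weak_topology UNIV norm) x l F" "filterlim r F G"
  shows "limitin (weak_topology UNIV norm) (\<lambda>n. x (r n)) l G"
  unfolding limitin_weak_topology_UNIV
proof (intro allI impI)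
  fix f :: "'a \<Rightarrow> real" assume "bounded_linear f"
  with assms(1) have "((\<lambda>n. f (x n)) \<longlongrightarrow> f l) F"
    by (simp add: limitin_weak_topology_UNIV)
  from filterlim_compose[OF this assms(2)] show "((\<lambda>n. f (x (r n))) \<longlongrightarrow> f l) G" .
qed

text \<open>A sequence \<open>x\<close> is turned into the family \<open>\<epsilon> \<mapsto> x \<lceil>1 / \<epsilon>\<rceil>\<close>, which takes the value \<open>x n\<close>
  at \<open>\<epsilon> = 1 / n\<close>.\<close>

lemma seq_weakly_lsc_compose:
  fixes s :: "'x::real_normed_vector \<Rightarrow> 'z::real_normed_vector \<Rightarrow> 'u::real_normed_vector"
  assumes g: "seq_weakly_lsc UNIV norm g"
    and s: "\<And>\<xi>n \<xi>0 zn z0.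
          (\<xi>n \<longlongrightarrow> \<xi>0) (at_right (0::real)) \<Longrightarrow>
          limitin (weak_topology UNIV norm) zn z0 (at_right 0) \<Longrightarrow>
          limitin (weak_topology UNIV norm) (\<lambda>\<epsilon>. s (\<xi>n \<epsilon>) (zn \<epsilon>)) (s \<xi>0 z0) (at_right 0)"
    and x: "x \<longlonglongrightarrow> \<xi>" and z: "limitin (weak_topology UNIV norm) z z0 sequentially"
  shows "g (s \<xi> z0) \<le> liminf (\<lambda>n. g (s (x n) (z n)))"
proof -
  let ?r = "\<lambda>\<epsilon>::real. nat \<lceil>1 / \<epsilon>\<rceil>"
  have "limitin (weak_topology UNIV norm) (\<lambda>\<epsilon>. s (x (?r \<epsilon>)) (z (?r \<epsilon>))) (s \<xi> z0) (at_right 0)"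
    using filterlim_nat_ceiling_inverse_at_right
    by (intro s filterlim_compose[OF x] limitin_weak_topology_UNIV_compose[OF z])
  from limitin_weak_topology_UNIV_compose[OF this filterlim_inverse_of_nat_at_right]
  have "limitin (weak_topology UNIV norm) (\<lambda>n. s (x n) (z n)) (s \<xi> z0) sequentially"
    by simp
  with g show ?thesis
    unfolding seq_weakly_lsc_def by simp
qed


section \<open>Lower semicontinuity of the smoothed expectation\<close>

text \<open>Writing the half-line as a condition on \<sigma> and \<tau> makes the integrand jointly
  measurable, so this is a parameter integral.\<close>

lemma borel_measurable_lebesgue_integral_atMost:
  fixes f :: "real \<Rightarrow> real"
  assumes [measurable]: "f \<in> borel_measurable borel"
  shows "(\<lambda>\<tau>. LBINT \<sigma>:{..\<tau>}. f \<sigma>) \<in> borel_measurable borel"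
proof -
  have [measurable]: "f \<in> borel_measurable lborel" by simp
  have "(\<lambda>\<tau>. \<integral>\<sigma>. (if \<sigma> \<le> \<tau> then f \<sigma> else 0) \<partial>lborel) \<in> borel_measurable borel"
    by measurable
  then show ?thesis
    by (simp add: set_lebesgue_integral_def indicator_def of_bool_def if_distrib[of "\<lambda>c. c * _"])
qed

lemma borel_measurable_smooth_step:
  assumes "smoothing_kernel \<zeta>"
  shows "smooth_step \<zeta> \<delta> \<in> borel_measurable borel"
proof -
  have [measurable]: "\<zeta> \<in> borel_measurable borel"
    using assms by (intro borel_measurable_continuous_onI) (simp add: smoothing_kernel_def)
  have "(\<lambda>\<sigma>. 1 / \<delta> * \<zeta> (\<sigma> / \<delta>)) \<in> borel_measurable borel"
    by measurable
  from borel_measurable_lebesgue_integral_atMost[OF this] show ?thesis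
    by (simp add: smooth_step_def[abs_def])
qed

text \<open>The level sets \<open>{\<tau>. ereal \<tau> \<le> x}\<close> and \<open>{\<tau>. ereal \<tau> < x}\<close> differ by a null set, and the
  indicator of the latter is lower semicontinuous in \<open>x\<close>.\<close>

lemma smooth_pos_part_le_liminf:
  assumes "smoothing_kernel \<zeta>" and le: "x \<le> liminf a"
  shows "smooth_pos_part \<zeta> \<delta> x \<le> liminf (\<lambda>n. smooth_pos_part \<zeta> \<delta> (a n))"
proof -
  note [measurable] = borel_measurable_smooth_step[OF assms(1)]
  have "smooth_pos_part \<zeta> \<delta> x
      \<le> (\<integral>\<^sup>+\<tau>. liminf (\<lambda>n. ennreal (smooth_step \<zeta> \<delta> \<tau>) * indicator {\<tau>. ereal \<tau> \<le> a n} \<tau>) \<partial>lborel)"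
    unfolding smooth_pos_part_def
  proof (rule nn_integral_mono_AE)
    show "AE \<tau> in lborel. ennreal (smooth_step \<zeta> \<delta> \<tau>) * indicator {\<tau>. ereal \<tau> \<le> x} \<tau>
        \<le> liminf (\<lambda>n. ennreal (smooth_step \<zeta> \<delta> \<tau>) * indicator {\<tau>. ereal \<tau> \<le> a n} \<tau>)"
      \<comment> \<open>Removing the point \<open>x\<close> makes the inequality strict. For
        infinite \<open>x\<close> the removed point is \<open>0\<close> by the convention of
        \<open>real_of_ereal\<close>, which does no harm.\<close>
      using AE_lborel_singleton[of "real_of_ereal x"]
    proof eventually_elim
      case (elim \<tau>)
      show ?case
      proof (cases "ereal \<tau> \<le> x")
        case True
        with elim have "ereal \<tau> < x" by (cases x) auto
        then have "ereal \<tau> < liminf a" using le by (rule less_le_trans)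
        then have "\<forall>\<^sub>F n in sequentially. ereal \<tau> < a n"
          by (rule less_LiminfD)
        then have "\<forall>\<^sub>F n in sequentially. ennreal (smooth_step \<zeta> \<delta> \<tau>) * indicator {\<tau>. ereal \<tau> \<le> x} \<tau>
            \<le> ennreal (smooth_step \<zeta> \<delta> \<tau>) * indicator {\<tau>. ereal \<tau> \<le> a n} \<tau>"
          by eventually_elim (use True in auto)
        then show ?thesis by (rule Liminf_bounded)
      qed simp
    qed
  qed
  also have "\<dots> \<le> liminf (\<lambda>n. smooth_pos_part \<zeta> \<delta> (a n))"
    unfolding smooth_pos_part_def by (rule nn_integral_liminf) measurable
  finally show ?thesis .
qed

text \<open>For \<open>z n\<close> fixed the integrand is lower semicontinuous in \<open>\<eta> n x\<close>, hence measurable, so that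
  Fatou's lemma applies.\<close>

lemma smoothed_expectation_le_liminf:
  fixes h :: "'x::real_normed_vector \<Rightarrow> 'z::real_normed_vector \<Rightarrow> ereal"
    and \<eta> :: "nat \<Rightarrow> 'a \<Rightarrow> 'x" and r :: "nat \<Rightarrow> 'a \<Rightarrow> real"
  assumes zeta: "smoothing_kernel \<zeta>"
    and lsc: "\<And>x \<xi> z z0. x \<longlonglongrightarrow> \<xi> \<Longrightarrow> limitin (weak_topology UNIV norm) z z0 sequentially \<Longrightarrow>
      h \<xi> z0 \<le> liminf (\<lambda>n. h (x n) (z n))"
    and z: "limitin (weak_topology UNIV norm) z z0 sequentially" and c: "c \<longlonglongrightarrow> c0"
    and D: "\<And>n. D n \<in> sets M" "AE x in M. \<forall>\<^sub>F n in sequentially. x \<in> D n"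
    and \<eta>: "\<And>n. bochner_measurable M (\<eta> n)" "AE x in M. (\<lambda>n. \<eta> n x) \<longlonglongrightarrow> \<tau> x"
    and r: "\<And>n. bochner_measurable M (r n)" "AE x in M. (\<lambda>n. r n x) \<longlonglongrightarrow> r0 x"
  shows "(\<integral>\<^sup>+x. smooth_pos_part \<zeta> \<delta> (h (\<tau> x) z0 - ereal c0) * ennreal (r0 x) \<partial>M)
    \<le> liminf (\<lambda>n. \<integral>\<^sup>+x\<in>D n. smooth_pos_part \<zeta> \<delta> (h (\<eta> n x) (z n) - ereal (c n)) * ennreal (r n x) \<partial>M)"
proof -
  define f0 where "f0 x = smooth_pos_part \<zeta> \<delta> (h (\<tau> x) z0 - ereal c0) * ennreal (r0 x)" for x
  define f where "f n x = smooth_pos_part \<zeta> \<delta> (h (\<eta> n x) (z n) - ereal (c n)) * ennreal (r n x)" for n x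
  \<comment> \<open>Stated for arbitrary \<open>z\<close> and \<open>c\<close> because it serves
    twice: along the given sequences for the pointwise bound, and along constant ones for
    measurability in \<xi>.\<close>
  have sp: "smooth_pos_part \<zeta> \<delta> (h \<xi> z0 - ereal c0)
      \<le> liminf (\<lambda>n. smooth_pos_part \<zeta> \<delta> (h (x n) (z n) - ereal (c n)))"
    if "x \<longlonglongrightarrow> \<xi>" "limitin (weak_topology UNIV norm) z z0 sequentially" "c \<longlonglongrightarrow> c0"
    for x \<xi> z z0 c c0
    using that by (intro smooth_pos_part_le_liminf zeta ereal_minus_le_liminf lsc)
  have "(\<integral>\<^sup>+x. f0 x \<partial>M) \<le> (\<integral>\<^sup>+x. liminf (\<lambda>n. f n x * indicator (D n) x) \<partial>M)"
  proof (rule nn_integral_mono_AE, use D(2) \<eta>(2) r(2) in eventually_elim)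
    case (elim x)
    have "f0 x \<le> liminf (\<lambda>n. f n x)"
      unfolding f0_def f_def using elim by (intro ennreal_mult_le_liminf sp z c tendsto_ennrealI)
    \<comment> \<open>Such a point eventually lies in \<open>D n\<close>, so the cut-off leaves the
      liminf unchanged.\<close>
    also have "\<dots> \<le> liminf (\<lambda>n. f n x * indicator (D n) x)"
      using elim(1) by (intro Liminf_mono) (auto elim: eventually_mono)
    finally show ?case .
  qed
  also have "\<dots> \<le> liminf (\<lambda>n. \<integral>\<^sup>+x. f n x * indicator (D n) x \<partial>M)"
  proof (rule nn_integral_liminf_AE)
    fix n
    obtain \<eta>' where \<eta>': "\<eta>' \<in> borel_measurable M" "AE x in M. \<eta> n x = \<eta>' x"
      using bochner_measurable_AE_eq_borel[OF \<eta>(1)[of n]] .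
    obtain r' where r': "r' \<in> borel_measurable M" "AE x in M. r n x = r' x"
      using bochner_measurable_AE_eq_borel[OF r(1)[of n]] .
    have "limitin (weak_topology UNIV norm) (\<lambda>_. z n) (z n) sequentially"
      unfolding limitin_weak_topology_UNIV by simp
    from sp[OF _ this tendsto_const]
    have "(\<lambda>\<xi>. smooth_pos_part \<zeta> \<delta> (h \<xi> (z n) - ereal (c n))) \<in> borel_measurable borel"
      by (rule borel_measurable_seq_lsc)
    note [measurable] = measurable_compose[OF \<eta>'(1) this] r'(1) D(1)[of n]
    show "\<exists>f'\<in>borel_measurable M. AE x in M. f n x * indicator (D n) x = f' x"
      by (rule bexI[of _ "\<lambda>x. smooth_pos_part \<zeta> \<delta> (h (\<eta>' x) (z n) - ereal (c n)) * ennreal (r' x)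
          * indicator (D n) x"]) (use \<eta>'(2) r'(2) in \<open>auto simp: f_def\<close>)
  qed
  finally show ?thesis unfolding f0_def f_def .
qed


section \<open>Gamma-convergence\<close>

theorem theorem4p3:
  fixes f0 :: "'z::banach \<Rightarrow> ereal"
    and g :: "'u::banach \<Rightarrow> ereal"
    and s :: "'x::real_normed_vector \<Rightarrow> 'z \<Rightarrow> 'u"
    and \<kappa> \<delta> q q' :: real
    and \<zeta> :: "real \<Rightarrow> real"
    and \<mu> \<PP> :: "'x measure"
    and \<rho> :: "'x \<Rightarrow> real"
    and \<Xi>t \<Xi>\<epsilon> :: "real \<Rightarrow> 'x set"
    and C :: "nat \<Rightarrow> 'x set"
    and W :: "real \<Rightarrow> ('x \<Rightarrow> real) set" and NW :: "real \<Rightarrow> ('x \<Rightarrow> real) \<Rightarrow> real"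
    and WW :: "real \<Rightarrow> ('x \<Rightarrow> 'x) set" and NWW :: "real \<Rightarrow> ('x \<Rightarrow> 'x) \<Rightarrow> real"
    and \<rho>\<epsilon> :: "real \<Rightarrow> 'x \<Rightarrow> real" and \<eta>\<epsilon> :: "real \<Rightarrow> 'x \<Rightarrow> 'x"
    and T\<epsilon> :: "real \<Rightarrow> ('x \<Rightarrow> real) set" and TT\<epsilon> :: "real \<Rightarrow> ('x \<Rightarrow> 'x) set"
    and Y :: "(('x \<Rightarrow> real) \<times> ('x \<Rightarrow> 'x)) set"
    and NY :: "('x \<Rightarrow> real) \<times> ('x \<Rightarrow> 'x) \<Rightarrow> real"
    and H :: "('x \<Rightarrow> real) \<times> ('x \<Rightarrow> 'x) \<Rightarrow> real"
    and \<theta> :: "real \<Rightarrow> real"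
  defines "\<rho> \<equiv> \<lambda>\<xi>. enn2real (RN_deriv \<mu> \<PP> \<xi>)"
    and "\<Xi>\<epsilon> \<equiv> \<lambda>\<epsilon>. \<Xi>t \<epsilon> \<inter> C (nat \<lceil>1 / \<epsilon>\<rceil>)"
    and "T\<epsilon> \<equiv> \<lambda>\<epsilon>. perturbation_space \<mu> q (\<Xi>\<epsilon> \<epsilon>) (W \<epsilon>) {\<rho>\<epsilon> \<epsilon>}"
    and "TT\<epsilon> \<equiv> \<lambda>\<epsilon>. perturbation_space \<mu> q' (\<Xi>\<epsilon> \<epsilon>) (WW \<epsilon>) {id, \<eta>\<epsilon> \<epsilon>}"
    and "Y \<equiv> Lp_space \<mu> q \<times> Lp_space \<mu> q'"
    and "NY \<equiv> prod_norm (Lp_norm \<mu> q) (Lp_norm \<mu> q')"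
  assumes Z_reflexive: "reflexive_space (UNIV :: 'z set) norm"
    and prob: "prob_space \<PP>" "sets \<PP> = sets \<mu>" "space \<mu> = UNIV"
    and mu: "sigma_finite_measure \<mu>" "absolutely_continuous \<mu> \<PP>"
    and s_measurable: "\<And>z. (\<lambda>\<xi>. s \<xi> z) \<in> borel_measurable \<mu>"
    and s_continuous: "\<And>\<xi>n \<xi>0 zn z0.
          (\<xi>n \<longlongrightarrow> \<xi>0) (at_right (0::real)) \<Longrightarrow>
          limitin (weak_topology UNIV norm) zn z0 (at_right 0) \<Longrightarrow>
          limitin (weak_topology UNIV norm) (\<lambda>\<epsilon>. s (\<xi>n \<epsilon>) (zn \<epsilon>)) (s \<xi>0 z0) (at_right 0)"
    and f0_proper: "\<And>z. f0 z > -\<infinity>" "\<exists>z. f0 z < \<infinity>"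
    and f0_lsc: "seq_weakly_lsc UNIV norm f0"
    and g_lsc: "seq_weakly_lsc UNIV norm g"
    and kappa: "0 \<le> \<kappa>"
    and q: "1 < q" "1 < q'" "1 / q + 1 / q' = 1"
    and id_Lq': "id \<in> Lp_space \<mu> q'"
    and zeta: "smoothing_kernel \<zeta>"
    and delta: "0 < \<delta>"
    and subdomains: "\<And>\<epsilon>. 0 < \<epsilon> \<Longrightarrow> \<Xi>t \<epsilon> \<in> sets \<mu>"
          "AE \<xi> in \<mu>. ((\<lambda>\<epsilon>. indicator (\<Xi>t \<epsilon>) \<xi> :: real) \<longlongrightarrow> 1) (at_right 0)"
    and cover: "incseq C" "\<And>n. C n \<in> sets \<mu>" "\<And>n. emeasure \<mu> (C n) < \<infinity>" "(\<Union>n. C n) = UNIV"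
    and W: "\<And>\<epsilon>. 0 < \<epsilon> \<Longrightarrow> reflexive_function_space \<mu> (\<Xi>\<epsilon> \<epsilon>) (W \<epsilon>) (NW \<epsilon>)"
    and WW: "\<And>\<epsilon>. 0 < \<epsilon> \<Longrightarrow> reflexive_function_space \<mu> (\<Xi>\<epsilon> \<epsilon>) (WW \<epsilon>) (NWW \<epsilon>)"
    and H_lsc: "weakly_lsc Y NY H"
    and H_coercive: "\<And>c. \<exists>r. \<forall>y\<in>Y. r \<le> NY y \<longrightarrow> c \<le> H y"
    and H_zero: "H (0, 0) = 0"
    and H_nonneg: "\<And>y. y \<in> Y \<Longrightarrow> 0 \<le> H y"
    and H_strong: "\<And>y :: nat \<Rightarrow> _. (\<And>k. y k \<in> Y) \<Longrightarrow> (\<lambda>k. H (y k)) \<longlonglongrightarrow> 0 \<Longrightarrow> (\<lambda>k. NY (y k)) \<longlonglongrightarrow> 0"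
    and theta: "\<And>\<epsilon>. 0 < \<epsilon> \<Longrightarrow> 0 \<le> \<theta> \<epsilon>"
    and rho: "\<And>\<epsilon>. 0 < \<epsilon> \<Longrightarrow> \<rho> \<in> densities \<mu> \<inter> T\<epsilon> \<epsilon>"
    and rho_eps: "\<And>\<epsilon>. 0 < \<epsilon> \<Longrightarrow> \<rho>\<epsilon> \<epsilon> \<in> densities_on \<mu> (\<Xi>\<epsilon> \<epsilon>) \<inter> T\<epsilon> \<epsilon>"
    and eta_eps: "\<And>\<epsilon>. 0 < \<epsilon> \<Longrightarrow> \<eta>\<epsilon> \<epsilon> \<in> Lp_supported \<mu> q' (\<Xi>\<epsilon> \<epsilon>) \<inter> TT\<epsilon> \<epsilon>"
    and theta_lim: "filterlim \<theta> at_top (at_right 0)"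
    and penalty_lim: "((\<lambda>\<epsilon>. \<theta> \<epsilon> * H (\<rho> - \<rho>\<epsilon> \<epsilon>, id - \<eta>\<epsilon> \<epsilon>)) \<longlongrightarrow> 0) (at_right 0)"
  shows "weak_strong_Gamma_converges (UNIV :: ('z \<times> real) set) norm Y NY
           (\<lambda>\<epsilon>. Phi_perturbed f0 g s \<kappa> \<zeta> \<delta> \<mu> H (\<Xi>\<epsilon> \<epsilon>) (T\<epsilon> \<epsilon>) (TT\<epsilon> \<epsilon>) (\<rho>\<epsilon> \<epsilon>) (\<eta>\<epsilon> \<epsilon>) (\<theta> \<epsilon>))
           (Phi_limit f0 g s \<kappa> \<zeta> \<delta> \<mu> \<rho>)"
proof -
  let ?\<Phi> = "\<lambda>\<epsilon>. Phi_perturbed f0 g s \<kappa> \<zeta> \<delta> \<mu> H (\<Xi>\<epsilon> \<epsilon>) (T\<epsilon> \<epsilon>) (TT\<epsilon> \<epsilon>) (\<rho>\<epsilon> \<epsilon>) (\<eta>\<epsilon> \<epsilon>) (\<theta> \<epsilon>)"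
  let ?\<Psi> = "Phi_limit f0 g s \<kappa> \<zeta> \<delta> \<mu> \<rho>"
  let ?E = "\<lambda>z \<gamma>. \<integral>\<^sup>+\<xi>. smooth_pos_part \<zeta> \<delta> (g (s \<xi> z) - ereal \<gamma>) * ennreal (\<rho> \<xi>) \<partial>\<mu>"
  let ?E\<epsilon> = "\<lambda>\<epsilon> z \<gamma> t tt. \<integral>\<^sup>+\<xi>\<in>\<Xi>\<epsilon> \<epsilon>.
    smooth_pos_part \<zeta> \<delta> (g (s (\<eta>\<epsilon> \<epsilon> \<xi> + tt \<xi>) z) - ereal \<gamma>) * ennreal (\<rho>\<epsilon> \<epsilon> \<xi> + t \<xi>) \<partial>\<mu>"

  \<comment> \<open>Integrability, the vanishing corruption, and the limit of the subdomains\<close>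
  have q0: "0 < q" "0 < q'" "1 \<le> q" using q by auto
  have \<Xi>\<epsilon>_meas: "\<Xi>\<epsilon> \<epsilon> \<in> sets \<mu>" "- \<Xi>\<epsilon> \<epsilon> \<in> sets \<mu>" if "0 < \<epsilon>" for \<epsilon>
  proof -
    show "\<Xi>\<epsilon> \<epsilon> \<in> sets \<mu>"
      using subdomains(1)[OF that] cover(2) by (simp add: \<Xi>\<epsilon>_def)
    from sets.compl_sets[OF this] show "- \<Xi>\<epsilon> \<epsilon> \<in> sets \<mu>"
      by (simp add: prob(3) Compl_eq_Diff_UNIV)
  qed
  have rho_Lq: "\<rho> \<in> Lp_space \<mu> q"
    using rho[of 1] densities_subset_Lp_space[OF q0(3)] by auto
  have rho_eps_Lq: "\<rho>\<epsilon> \<epsilon> \<in> Lp_space \<mu> q" if "0 < \<epsilon>" for \<epsilon>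
    using rho_eps[OF that] densities_subset_Lp_space[OF q0(3)] densities_on_subset_densities by blast
  have eta_eps_Lq': "\<eta>\<epsilon> \<epsilon> \<in> Lp_space \<mu> q'" if "0 < \<epsilon>" for \<epsilon>
    using eta_eps[OF that] by (simp add: Lp_supported_def)
  have corr_Y: "(\<rho> - \<rho>\<epsilon> \<epsilon>, id - \<eta>\<epsilon> \<epsilon>) \<in> Y" if "0 < \<epsilon>" for \<epsilon>
    using rho_Lq rho_eps_Lq[OF that] id_Lq' eta_eps_Lq'[OF that] q0
    by (simp add: Y_def Lp_space_diff)
  have corr_lim: "((\<lambda>\<epsilon>. NY (\<rho> - \<rho>\<epsilon> \<epsilon>, id - \<eta>\<epsilon> \<epsilon>)) \<longlongrightarrow> 0) (at_right 0)"
  \<comment> \<open>\<open>H_strong\<close> speaks of sequences, so the limit is tested along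
    sequences tending to \<open>0\<close> from the right; the upper end \<open>1\<close> is
    arbitrary.\<close>
  proof (rule tendsto_at_right_sequentially[of 0 1])
    fix e :: "nat \<Rightarrow> real" assume e: "\<And>n. 0 < e n" "e \<longlonglongrightarrow> 0"
    let ?H = "\<lambda>n. H (\<rho> - \<rho>\<epsilon> (e n), id - \<eta>\<epsilon> (e n))"
    note e_lim = filterlim_at_right_sequentiallyI[OF e]
    have "?H \<longlonglongrightarrow> 0"
    proof (rule tendsto_sandwich[OF _ _ tendsto_const])
      show "\<forall>\<^sub>F n in sequentially. 0 \<le> ?H n"
        using H_nonneg corr_Y e(1) by simp
      \<comment> \<open>Once the penalty parameter is at least one, the unweighted \<open>H\<close>
        lies between zero and the weighted penalty.\<close>
      have "\<forall>\<^sub>F n in sequentially. 1 \<le> \<theta> (e n)"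
        using filterlim_compose[OF theta_lim e_lim] by (simp add: filterlim_at_top)
      then show "\<forall>\<^sub>F n in sequentially. ?H n \<le> \<theta> (e n) * ?H n"
      proof eventually_elim
        case (elim n)
        then show ?case
          using mult_right_mono[OF elim, of "?H n"] H_nonneg[OF corr_Y[OF e(1)]] by simp
      qed
      show "(\<lambda>n. \<theta> (e n) * ?H n) \<longlonglongrightarrow> 0"
        by (rule filterlim_compose[OF penalty_lim e_lim])
    qed
    then show "(\<lambda>n. NY (\<rho> - \<rho>\<epsilon> (e n), id - \<eta>\<epsilon> (e n))) \<longlonglongrightarrow> 0"
      using corr_Y e(1) by (intro H_strong) auto
  qed simp
  have AE_zero: "AE \<xi> in \<mu>. t \<xi> = 0 \<and> tt \<xi> = 0" if "(t, tt) \<in> Y" "NY (t, tt) = 0" for t tt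
  proof -
    have "Lp_norm \<mu> q t = 0" "Lp_norm \<mu> q' tt = 0"
      using that(2) Lp_norm_nonneg[of \<mu> q t] Lp_norm_nonneg[of \<mu> q' tt]
      unfolding NY_def prod_norm_def by (auto simp: add_nonneg_eq_0_iff)
    with that(1) show ?thesis
      by (auto simp: Y_def dest: Lp_norm_eq_0_AE)
  qed
  \<comment> \<open>The limit point is zero only up to null sets; this reduces the distance to it to
    \<open>NY\<close> itself.\<close>
  have NY_cong: "NY (y - (t, tt)) = NY y" if "AE \<xi> in \<mu>. t \<xi> = 0 \<and> tt \<xi> = 0" for y t tt
  proof -
    have "Lp_norm \<mu> q (fst y - t) = Lp_norm \<mu> q (fst y)"
      by (rule Lp_norm_cong_AE) (use that in auto)
    moreover have "Lp_norm \<mu> q' (snd y - tt) = Lp_norm \<mu> q' (snd y)"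
      by (rule Lp_norm_cong_AE) (use that in auto)
    ultimately show ?thesis
      by (simp add: NY_def prod_norm_def case_prod_beta)
  qed
  have \<Xi>\<epsilon>_lim: "AE \<xi> in \<mu>. \<forall>\<^sub>F \<epsilon> in at_right 0. \<xi> \<in> \<Xi>\<epsilon> \<epsilon>"
    using subdomains(2)
  proof eventually_elim
    case (elim \<xi>)
    \<comment> \<open>An indicator takes only the values zero and one, so exceeding one half is
      membership.\<close>
    have "\<forall>\<^sub>F \<epsilon> in at_right 0. (1 / 2 :: real) < indicator (\<Xi>t \<epsilon>) \<xi>"
      by (rule order_tendstoD(1)[OF elim]) simp
    then have 1: "\<forall>\<^sub>F \<epsilon> in at_right 0. \<xi> \<in> \<Xi>t \<epsilon>"
      by (rule eventually_mono) (rule ccontr, simp)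
    obtain N where "\<xi> \<in> C N" using cover(4) by blast
    then have "\<xi> \<in> C n" if "N \<le> n" for n
      using incseqD[OF cover(1) that] by blast
    moreover have "\<forall>\<^sub>F \<epsilon> in at_right (0::real). N \<le> nat \<lceil>1 / \<epsilon>\<rceil>"
      using filterlim_nat_ceiling_inverse_at_right by (simp add: filterlim_at_top)
    ultimately have "\<forall>\<^sub>F \<epsilon> in at_right (0::real). \<xi> \<in> C (nat \<lceil>1 / \<epsilon>\<rceil>)"
      by (auto elim: eventually_mono)
    with 1 show ?case
      unfolding \<Xi>\<epsilon>_def by eventually_elim simp
  qed

  \<comment> \<open>The limsup inequality along a recovery sequence\<close>
  have recovery: "\<exists>(x\<epsilon> :: real \<Rightarrow> 'z \<times> real) (y\<epsilon> :: real \<Rightarrow> _). (\<forall>\<epsilon>>0. x\<epsilon> \<epsilon> \<in> UNIV \<and> y\<epsilon> \<epsilon> \<in> Y) \<and>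
      ((\<lambda>\<epsilon>. norm (x\<epsilon> \<epsilon> - x)) \<longlongrightarrow> 0) (at_right 0) \<and>
      ((\<lambda>\<epsilon>. NY (y\<epsilon> \<epsilon> - y)) \<longlongrightarrow> 0) (at_right 0) \<and>
      Limsup (at_right 0) (\<lambda>\<epsilon>. ?\<Phi> \<epsilon> (x\<epsilon> \<epsilon>) (y\<epsilon> \<epsilon>)) \<le> ?\<Psi> x y" if "y \<in> Y" for x :: "'z \<times> real" and y
  proof (cases x, cases y)
    fix z \<gamma> t tt assume xy: "x = (z, \<gamma>)" "y = (t, tt)"
    show ?thesis
    proof (cases "AE \<xi> in \<mu>. t \<xi> = 0 \<and> tt \<xi> = 0")
      \<comment> \<open>The limit functional is infinite here, so constant families suffice.\<close>
      case False
      then have "?\<Psi> x y = \<infinity>"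
        by (auto simp: Phi_limit_def xy)
      moreover have "NY (y - y) = 0"
        by (simp add: NY_def prod_norm_def Lp_norm_def zero_prod_def)
      ultimately show ?thesis
        using that by (intro exI[of _ "\<lambda>_. x"] exI[of _ "\<lambda>_. y"]) simp
    next
      case True
      let ?y = "\<lambda>\<epsilon>. (\<rho> - \<rho>\<epsilon> \<epsilon>, id - \<eta>\<epsilon> \<epsilon>)"
      \<comment> \<open>With this choice the integrand is the limiting one, but it is integrated
        over the subdomain alone. The part left out is nonnegative, hence an inequality.\<close>
      have "?\<Phi> \<epsilon> x (?y \<epsilon>) \<le> ?\<Psi> x y + ereal (\<theta> \<epsilon> * H (?y \<epsilon>))" if \<epsilon>: "0 < \<epsilon>" for \<epsilon>
      proof -
        have sub: "subspace (W \<epsilon>)" "subspace (WW \<epsilon>)"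
          using W[OF \<epsilon>] WW[OF \<epsilon>] by (simp_all add: reflexive_function_space_def seminormed_space_def)
        \<comment> \<open>Both densities lie in the space by assumption, while for the second
          component \<open>id\<close> and \<open>\<eta>\<epsilon> \<epsilon>\<close> are spanning
          functions of the space.\<close>
        have "\<rho> - \<rho>\<epsilon> \<epsilon> \<in> T\<epsilon> \<epsilon>"
          using rho[OF \<epsilon>] rho_eps[OF \<epsilon>] sub(1) q0 unfolding T\<epsilon>_def
          by (intro perturbation_space_diff) auto
        moreover have "id - \<eta>\<epsilon> \<epsilon> \<in> TT\<epsilon> \<epsilon>"
          unfolding TT\<epsilon>_def
          by (rule span_subset_perturbation_space[OF sub(2) \<Xi>\<epsilon>_meas(2)[OF \<epsilon>]])
             (auto intro: span_diff span_base Lp_space_diff id_Lq' eta_eps_Lq'[OF \<epsilon>] q0)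
        ultimately have \<Phi>_eq: "?\<Phi> \<epsilon> x (?y \<epsilon>) =
            f0 z + ereal \<gamma> + ereal \<kappa> * enn2ereal (?E\<epsilon> \<epsilon> z \<gamma> (\<rho> - \<rho>\<epsilon> \<epsilon>) (id - \<eta>\<epsilon> \<epsilon>))
            + ereal (\<theta> \<epsilon> * H (?y \<epsilon>))"
          using rho[OF \<epsilon>] by (simp add: Phi_perturbed_def indicator_functional_def xy)
        have \<Psi>_eq: "?\<Psi> x y = f0 z + ereal \<gamma> + ereal \<kappa> * enn2ereal (?E z \<gamma>)"
          using True by (simp add: Phi_limit_def xy)
        have "?E\<epsilon> \<epsilon> z \<gamma> (\<rho> - \<rho>\<epsilon> \<epsilon>) (id - \<eta>\<epsilon> \<epsilon>) \<le> ?E z \<gamma>"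
          by (intro nn_integral_mono) (auto simp: indicator_def)
        then have "ereal \<kappa> * enn2ereal (?E\<epsilon> \<epsilon> z \<gamma> (\<rho> - \<rho>\<epsilon> \<epsilon>) (id - \<eta>\<epsilon> \<epsilon>))
            \<le> ereal \<kappa> * enn2ereal (?E z \<gamma>)"
          using kappa by (intro ereal_mult_left_mono) (simp_all add: less_eq_ennreal.rep_eq)
        then show ?thesis
          unfolding \<Phi>_eq \<Psi>_eq by (intro add_mono order_refl)
      qed
      with eventually_at_right_less[of 0] have "\<forall>\<^sub>F \<epsilon> in at_right 0. ?\<Phi> \<epsilon> x (?y \<epsilon>) \<le> ?\<Psi> x y + ereal (\<theta> \<epsilon> * H (?y \<epsilon>))"
        by (rule eventually_mono)
      then have "Limsup (at_right 0) (\<lambda>\<epsilon>. ?\<Phi> \<epsilon> x (?y \<epsilon>))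
          \<le> Limsup (at_right 0) (\<lambda>\<epsilon>. ?\<Psi> x y + ereal (\<theta> \<epsilon> * H (?y \<epsilon>)))"
        by (rule Limsup_mono)
      also have "((\<lambda>\<epsilon>. ?\<Psi> x y + ereal (\<theta> \<epsilon> * H (?y \<epsilon>))) \<longlongrightarrow> ?\<Psi> x y) (at_right 0)"
      \<comment> \<open>An infinite value absorbs the real penalty term; next to a finite value that
        term tends to zero by \<open>penalty_lim\<close>.\<close>
      proof (cases "?\<Psi> x y")
        case (real r)
        then show ?thesis
          using tendsto_add[OF tendsto_const[of r] penalty_lim] by simp
      qed simp_all
      then have "Limsup (at_right 0) (\<lambda>\<epsilon>. ?\<Psi> x y + ereal (\<theta> \<epsilon> * H (?y \<epsilon>))) = ?\<Psi> x y"
        by (simp add: lim_imp_Limsup)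
      finally have "Limsup (at_right 0) (\<lambda>\<epsilon>. ?\<Phi> \<epsilon> x (?y \<epsilon>)) \<le> ?\<Psi> x y" .
      then show ?thesis
        using corr_Y corr_lim
        by (intro exI[of _ "\<lambda>_. x"] exI[of _ ?y]) (simp add: NY_cong[OF True, folded xy(2)])
    qed
  qed

  \<comment> \<open>The liminf inequality for weakly convergent arguments\<close>
  have h_lsc: "g (s \<xi> z0) \<le> liminf (\<lambda>n. g (s (x n) (z n)))"
    if "x \<longlonglongrightarrow> \<xi>" "limitin (weak_topology UNIV norm) z z0 sequentially" for x \<xi> z z0
    by (rule seq_weakly_lsc_compose[OF g_lsc _ that]) (rule s_continuous)

  have lower: "?\<Psi> x y \<le> Liminf (at_right 0) (\<lambda>\<epsilon>. ?\<Phi> \<epsilon> (x\<epsilon> \<epsilon>) (y\<epsilon> \<epsilon>))"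
    if y: "y \<in> Y" "\<And>\<epsilon>. 0 < \<epsilon> \<Longrightarrow> y\<epsilon> \<epsilon> \<in> Y" "((\<lambda>\<epsilon>. NY (y\<epsilon> \<epsilon> - y)) \<longlongrightarrow> 0) (at_right 0)"
      and x: "limitin (weak_topology UNIV norm) x\<epsilon> x (at_right 0)" for x y x\<epsilon> y\<epsilon>
  proof (rule Liminf_at_right_geI)
    fix e :: "nat \<Rightarrow> real" assume e: "\<And>k. 0 < e k" "filterlim e (at_right 0) sequentially"
    define z where "z k = fst (x\<epsilon> (e k))" for k
    define c where "c k = snd (x\<epsilon> (e k))" for k
    define t where "t k = fst (y\<epsilon> (e k))" for k
    define tt where "tt k = snd (y\<epsilon> (e k))" for k
    define I where "I k = ?E\<epsilon> (e k) (z k) (c k) (t k) (tt k)" for k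
    have x_eq: "x\<epsilon> (e k) = (z k, c k)" and y_eq: "y\<epsilon> (e k) = (t k, tt k)" for k
      by (simp_all add: z_def c_def t_def tt_def)
    have Yk: "(t k, tt k) \<in> Y" for k
      using y(2)[OF e(1)] by (simp flip: y_eq)
    have xk: "limitin (weak_topology UNIV norm) (\<lambda>k. x\<epsilon> (e k)) x sequentially"
      by (rule limitin_weak_topology_UNIV_compose[OF x e(2)])
    have zk: "limitin (weak_topology UNIV norm) z (fst x) sequentially"
      unfolding limitin_weak_topology_UNIV
    proof (intro allI impI)
      fix f :: "'z \<Rightarrow> real" assume "bounded_linear f"
      from xk[unfolded limitin_weak_topology_UNIV, rule_format,
          OF bounded_linear_compose[OF this bounded_linear_fst]]
      show "(\<lambda>k. f (z k)) \<longlonglongrightarrow> f (fst x)"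
        by (simp add: z_def)
    qed
    have ck: "c \<longlonglongrightarrow> snd x"
      using xk[unfolded limitin_weak_topology_UNIV, rule_format, OF bounded_linear_snd]
      by (simp add: c_def[abs_def])
    have f0_k: "f0 (fst x) \<le> liminf (\<lambda>k. f0 (z k))"
      using f0_lsc zk by (simp add: seq_weakly_lsc_def)
    have f0_c: "f0 (fst x) + ereal (snd x) \<le> liminf (\<lambda>k. f0 (z k) + ereal (c k))"
    proof -
      have "liminf (\<lambda>k. ereal (c k) + f0 (z k)) = ereal (snd x) + liminf (\<lambda>k. f0 (z k))"
        using ck by (intro ereal_liminf_lim_add) auto
      then show ?thesis
        using f0_k by (simp add: add.commute add_mono)
    qed
    \<comment> \<open>Excludes a sum of opposite infinities when the liminf of the functional is
      split into terms; this is where \<open>f0_proper\<close> enters.\<close>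
    have f0_c_bot: "liminf (\<lambda>k. f0 (z k) + ereal (c k)) \<noteq> - \<infinity>"
      using f0_c f0_proper(1)[of "fst x"] by (cases "f0 (fst x)") auto
    have \<kappa>I: "0 \<le> ereal \<kappa> * enn2ereal (I k)" for k
      using kappa by simp
    \<comment> \<open>The indicator functionals are zero or infinite, so leaving them out can only
      lower the value.\<close>
    have \<Phi>_ge: "f0 (z k) + ereal (c k) + ereal \<kappa> * enn2ereal (I k) + ereal (\<theta> (e k) * H (t k, tt k))
        \<le> ?\<Phi> (e k) (x\<epsilon> (e k)) (y\<epsilon> (e k))" for k
      unfolding x_eq y_eq Phi_perturbed_def I_def
      by (auto simp: indicator_functional_def)
    have \<theta>H: "0 \<le> \<theta> (e k) * H (t k, tt k)" for k
      using theta[OF e(1)] H_nonneg[OF Yk] by simp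
    show "\<exists>r. strict_mono r \<and> ?\<Psi> x y \<le> liminf (\<lambda>k. ?\<Phi> (e (r k)) (x\<epsilon> (e (r k))) (y\<epsilon> (e (r k))))"
    proof (cases "AE \<xi> in \<mu>. fst y \<xi> = 0 \<and> snd y \<xi> = 0")
      case False
      \<comment> \<open>By \<open>H_strong\<close> for the constant sequence \<open>y\<close>, a
        zero of \<open>H\<close> would force \<open>NY y = 0\<close>, and \<open>y\<close> would
        vanish a.e.\<close>
      have "H y \<noteq> 0"
      proof
        assume "H y = 0"
        then have "NY y = 0"
          using H_strong[of "\<lambda>_. y"] y(1) by (simp add: LIMSEQ_const_iff)
        with AE_zero[of "fst y" "snd y"] y(1) False show False by simp
      qed
      then have Hy: "0 < H y" using H_nonneg[OF y(1)] by simp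
      \<comment> \<open>Any threshold strictly between \<open>0\<close> and \<open>H y\<close> would
        do: it bounds \<open>H\<close> away from zero, so the factor \<theta> drives the penalty to
        infinity.\<close>
      have "\<forall>\<^sub>F \<epsilon> in at_right 0. H y / 2 < H (y\<epsilon> \<epsilon>)"
      proof (rule weakly_lsc_eventually_gt[OF H_lsc y(1)])
        show "a - b \<in> Y" if "a \<in> Y" "b \<in> Y" for a b
          using that q0 by (auto simp: Y_def intro!: Lp_space_diff)
        show "\<forall>\<^sub>F \<epsilon> in at_right 0. y\<epsilon> \<epsilon> \<in> Y"
          using eventually_at_right_less[of 0] y(2) by (rule eventually_mono)
      qed (use y(3) Hy in auto)
      then have Hk: "\<forall>\<^sub>F k in sequentially. H y / 2 < H (t k, tt k)"
        using eventually_compose_filterlim[OF _ e(2)] by (simp flip: y_eq)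
      have \<theta>k: "filterlim (\<lambda>k. \<theta> (e k)) at_top sequentially"
        by (rule filterlim_compose[OF theta_lim e(2)])
      have "filterlim (\<lambda>k. \<theta> (e k) * (H y / 2)) at_top sequentially"
        using Hy \<theta>k by (intro filterlim_at_top_mult_tendsto_pos[OF tendsto_const]) auto
      then have "filterlim (\<lambda>k. \<theta> (e k) * H (t k, tt k)) at_top sequentially"
      proof (rule filterlim_at_top_mono)
        show "\<forall>\<^sub>F k in sequentially. \<theta> (e k) * (H y / 2) \<le> \<theta> (e k) * H (t k, tt k)"
          using Hk by eventually_elim (intro mult_left_mono, auto intro: theta e(1))
      qed
      then have "liminf (\<lambda>k. ereal (\<theta> (e k) * H (t k, tt k))) = \<infinity>"
        by (simp add: tendsto_PInfty_eq_at_top lim_imp_Liminf)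
      then have "\<infinity> = liminf (\<lambda>k. f0 (z k) + ereal (c k)) + liminf (\<lambda>k. ereal (\<theta> (e k) * H (t k, tt k)))"
        using f0_c_bot by simp
      also have "\<dots> \<le> liminf (\<lambda>k. f0 (z k) + ereal (c k) + ereal (\<theta> (e k) * H (t k, tt k)))"
        using f0_c_bot \<open>liminf (\<lambda>k. ereal (\<theta> (e k) * H (t k, tt k))) = \<infinity>\<close>
        by (intro ereal_liminf_add_mono) auto
      also have "\<dots> \<le> liminf (\<lambda>k. ?\<Phi> (e k) (x\<epsilon> (e k)) (y\<epsilon> (e k)))"
      proof (intro Liminf_mono always_eventually allI)
        fix k
        have "f0 (z k) + ereal (c k) \<le> f0 (z k) + ereal (c k) + ereal \<kappa> * enn2ereal (I k)"
          using add_left_mono[OF \<kappa>I] by simp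
        then show "f0 (z k) + ereal (c k) + ereal (\<theta> (e k) * H (t k, tt k))
            \<le> ?\<Phi> (e k) (x\<epsilon> (e k)) (y\<epsilon> (e k))"
          using \<Phi>_ge[of k] by (meson add_right_mono order_trans)
      qed
      finally have "?\<Psi> x y \<le> liminf (\<lambda>k. ?\<Phi> (e k) (x\<epsilon> (e k)) (y\<epsilon> (e k)))"
        by simp
      \<comment> \<open>The penalty diverges along the whole sequence, so the subsequence is the
        identity.\<close>
      then show ?thesis
        by (intro exI[of _ id]) (simp add: strict_mono_id)
    next
      case True
      have "(\<lambda>k. NY (\<rho> - \<rho>\<epsilon> (e k), id - \<eta>\<epsilon> (e k))) \<longlonglongrightarrow> 0"
        by (rule filterlim_compose[OF corr_lim e(2)])
      then obtain r1 :: "nat \<Rightarrow> nat" where r1: "strict_mono r1"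
        "AE \<xi> in \<mu>. (\<lambda>k. (\<rho> - \<rho>\<epsilon> (e (r1 k))) \<xi>) \<longlonglongrightarrow> 0"
        "AE \<xi> in \<mu>. (\<lambda>k. (id - \<eta>\<epsilon> (e (r1 k))) \<xi>) \<longlonglongrightarrow> 0"
        using Lp_pair_tendsto_0_AE_subseq[OF q0(1,2), of "\<lambda>k. \<rho> - \<rho>\<epsilon> (e k)" \<mu> "\<lambda>k. id - \<eta>\<epsilon> (e k)"]
          corr_Y[OF e(1)] unfolding Y_def NY_def by blast
      have "(\<lambda>k. NY (t (r1 k), tt (r1 k))) \<longlonglongrightarrow> 0"
      proof -
        have "(\<lambda>k. NY (y\<epsilon> (e k) - y)) \<longlonglongrightarrow> 0"
          by (rule filterlim_compose[OF y(3) e(2)])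
        then have "(\<lambda>k. NY (t k, tt k)) \<longlonglongrightarrow> 0"
          using NY_cong[of "fst y" "snd y"] True by (simp add: y_eq)
        from LIMSEQ_subseq_LIMSEQ[OF this r1(1)] show ?thesis by (simp add: comp_def)
      qed
      \<comment> \<open>Extracted from \<open>r1\<close>, so that the composite subsequence gives
        a.e. convergence of the corruption and of the perturbation together.\<close>
      then obtain r2 :: "nat \<Rightarrow> nat" where r2: "strict_mono r2"
        "AE \<xi> in \<mu>. (\<lambda>k. t (r1 (r2 k)) \<xi>) \<longlonglongrightarrow> 0" "AE \<xi> in \<mu>. (\<lambda>k. tt (r1 (r2 k)) \<xi>) \<longlonglongrightarrow> 0"
        using Lp_pair_tendsto_0_AE_subseq[OF q0(1,2), of "\<lambda>k. t (r1 k)" \<mu> "\<lambda>k. tt (r1 k)"] Yk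
        unfolding Y_def NY_def by blast
      define r where "r k = r1 (r2 k)" for k
      have r: "strict_mono r"
        using strict_mono_o[OF r1(1) r2(1)] by (simp add: comp_def r_def[abs_def])
      then have r_lim: "filterlim r at_top sequentially"
        by (rule filterlim_subseq)
      \<comment> \<open>The sums are formed as functions before evaluation, to match the sequences
        of Bochner measurable functions in \<open>smoothed_expectation_le_liminf\<close>;
        simplification with \<open>I_def\<close> undoes this afterwards.\<close>
      have "?E (fst x) (snd x) \<le> liminf (\<lambda>k. \<integral>\<^sup>+\<xi>\<in>\<Xi>\<epsilon> (e (r k)).
          smooth_pos_part \<zeta> \<delta> (g (s ((\<eta>\<epsilon> (e (r k)) + tt (r k)) \<xi>) (z (r k))) - ereal (c (r k)))
          * ennreal ((\<rho>\<epsilon> (e (r k)) + t (r k)) \<xi>) \<partial>\<mu>)"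
      proof (rule smoothed_expectation_le_liminf[where h = "\<lambda>\<xi> z. g (s \<xi> z)" and z = "\<lambda>k. z (r k)"
            and c = "\<lambda>k. c (r k)" and \<tau> = "\<lambda>\<xi>. \<xi>", OF zeta])
        show "limitin (weak_topology UNIV norm) (\<lambda>k. z (r k)) (fst x) sequentially"
          by (rule limitin_weak_topology_UNIV_compose[OF zk r_lim])
        show "(\<lambda>k. c (r k)) \<longlonglongrightarrow> snd x"
          by (rule filterlim_compose[OF ck r_lim])
        show "\<Xi>\<epsilon> (e (r k)) \<in> sets \<mu>" for k
          by (rule \<Xi>\<epsilon>_meas[OF e(1)])
        show "AE \<xi> in \<mu>. \<forall>\<^sub>F k in sequentially. \<xi> \<in> \<Xi>\<epsilon> (e (r k))"
          using \<Xi>\<epsilon>_lim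
          by eventually_elim (rule eventually_compose_filterlim[OF _ filterlim_compose[OF e(2) r_lim]])
        show "bochner_measurable \<mu> (\<eta>\<epsilon> (e (r k)) + tt (r k))" for k
          using eta_eps_Lq'[OF e(1)[of "r k"]] Yk[of "r k"]
          by (auto simp: Y_def Lp_space_def intro: bochner_measurable_add)
        show "bochner_measurable \<mu> (\<rho>\<epsilon> (e (r k)) + t (r k))" for k
          using rho_eps_Lq[OF e(1)[of "r k"]] Yk[of "r k"]
          by (auto simp: Y_def Lp_space_def intro: bochner_measurable_add)
        show "AE \<xi> in \<mu>. (\<lambda>k. (\<eta>\<epsilon> (e (r k)) + tt (r k)) \<xi>) \<longlonglongrightarrow> \<xi>"
          using r1(3) r2(3)
        proof eventually_elim
          case (elim \<xi>)
          from LIMSEQ_subseq_LIMSEQ[OF elim(1) r2(1)]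
          have "(\<lambda>k. (id - \<eta>\<epsilon> (e (r k))) \<xi>) \<longlonglongrightarrow> 0" by (simp add: comp_def r_def)
          \<comment> \<open>The perturbed argument is \<xi> minus the corruption plus the
            perturbation, and the last two vanish in the limit. The density is treated alike
            below.\<close>
          from tendsto_add[OF tendsto_diff[OF tendsto_const[of \<xi>] this] elim(2)]
          show ?case by (simp add: r_def)
        qed
        show "AE \<xi> in \<mu>. (\<lambda>k. (\<rho>\<epsilon> (e (r k)) + t (r k)) \<xi>) \<longlonglongrightarrow> \<rho> \<xi>"
          using r1(2) r2(2)
        proof eventually_elim
          case (elim \<xi>)
          from LIMSEQ_subseq_LIMSEQ[OF elim(1) r2(1)]
          have "(\<lambda>k. (\<rho> - \<rho>\<epsilon> (e (r k))) \<xi>) \<longlonglongrightarrow> 0" by (simp add: comp_def r_def)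
          from tendsto_add[OF tendsto_diff[OF tendsto_const[of "\<rho> \<xi>"] this] elim(2)]
          show ?case by (simp add: r_def)
        qed
      qed (rule h_lsc)
      then have "?E (fst x) (snd x) \<le> liminf (\<lambda>k. I (r k))"
        by (simp add: I_def)
      then have \<kappa>E: "ereal \<kappa> * enn2ereal (?E (fst x) (snd x))
          \<le> liminf (\<lambda>k. ereal \<kappa> * enn2ereal (I (r k)))"
        using kappa
        by (simp add: Liminf_ereal_mult_left liminf_enn2ereal ereal_mult_left_mono less_eq_ennreal.rep_eq)
      \<comment> \<open>Passing to a subsequence can only raise the liminf, so the bound for these
        two terms survives.\<close>
      have "liminf (\<lambda>k. f0 (z k) + ereal (c k)) \<le> liminf (\<lambda>k. f0 (z (r k)) + ereal (c (r k)))"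
        using liminf_subseq_mono[OF r, of "\<lambda>k. f0 (z k) + ereal (c k)"] by (simp add: comp_def)
      with f0_c f0_c_bot
      have f0_r: "f0 (fst x) + ereal (snd x) \<le> liminf (\<lambda>k. f0 (z (r k)) + ereal (c (r k)))"
        "liminf (\<lambda>k. f0 (z (r k)) + ereal (c (r k))) \<noteq> - \<infinity>"
        by auto
      have "0 \<le> liminf (\<lambda>k. ereal \<kappa> * enn2ereal (I (r k)))"
        using \<kappa>I by (intro Liminf_bounded) simp
      then have \<kappa>I_bot: "liminf (\<lambda>k. ereal \<kappa> * enn2ereal (I (r k))) \<noteq> - \<infinity>"
        by auto
      have "?\<Psi> x y = f0 (fst x) + ereal (snd x) + ereal \<kappa> * enn2ereal (?E (fst x) (snd x))"
        using True by (simp add: Phi_limit_def case_prod_beta)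
      also have "\<dots> \<le> liminf (\<lambda>k. f0 (z (r k)) + ereal (c (r k)))
          + liminf (\<lambda>k. ereal \<kappa> * enn2ereal (I (r k)))"
        by (intro add_mono f0_r(1) \<kappa>E)
      also have "\<dots> \<le> liminf (\<lambda>k. f0 (z (r k)) + ereal (c (r k)) + ereal \<kappa> * enn2ereal (I (r k)))"
        using f0_r(2) \<kappa>I_bot by (intro ereal_liminf_add_mono) auto
      also have "\<dots> \<le> liminf (\<lambda>k. ?\<Phi> (e (r k)) (x\<epsilon> (e (r k))) (y\<epsilon> (e (r k))))"
      proof (intro Liminf_mono always_eventually allI)
        fix k
        \<comment> \<open>The penalty is nonnegative and may be dropped from a lower bound.\<close>
        show "f0 (z (r k)) + ereal (c (r k)) + ereal \<kappa> * enn2ereal (I (r k))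
            \<le> ?\<Phi> (e (r k)) (x\<epsilon> (e (r k))) (y\<epsilon> (e (r k)))"
          using \<Phi>_ge[of "r k"] \<theta>H[of "r k"]
          by (meson add_increasing2 ereal_less_eq(5) order_refl order_trans)
      qed
      finally show ?thesis
        using r by blast
    qed
  qed
  show ?thesis
    unfolding weak_strong_Gamma_converges_def
    using recovery lower by blast
qed

end
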